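(* Let $n\ge 3$ be an odd integer and $G=\langle\sigma,\tau:\sigma^n=\tau^2=1,\ \tau\sigma\tau^{-1}=\sigma^{-1}\rangle\simeq D_n$. Then there is an isomorphism of $G$-lattices $$\widetilde{M}_+\oplus\mathbb{Z}\simeq\mathbb{Z}[G/\langle\sigma\rangle]\oplus\mathbb{Z}[G/\langle\tau\rangle].$$
   Context: A $G$-lattice is a finitely generated $\mathbb{Z}[G]$-module that is torsion-free as an abelian group. $\mathbb{Z}$ is the trivial $G$-lattice. For a subgroup $S\le G$, $\mathbb{Z}[G/S]=\mathbb{Z}[G]\otimes_{\mathbb{Z}[S]}\mathbb{Z}$ is the permutation lattice on the cosets of $S$. The $G$-lattice $\widetilde{M}_+$ of rank $n+1$ has $\mathbb{Z}$-basis $x_0,\ldots,x_{n-1},w$ with action (indices modulo $n$) $$\sigma: x_i\mapsto x_{i+1},\ w\mapsto w;\qquad \tau: x_i\mapsto x_{-i},\ w\mapsto -w+\sum_{0\le i\le n-1}x_i.$$ *)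

theory Defs
  imports "HOL-Algebra.Algebra"
begin

section \<open>Group presentations\<close>

text \<open>A word is a list of letters; \<open>(x, True)\<close> stands for the generator \<open>x\<close> and
  \<open>(x, False)\<close> for its formal inverse.\<close>

type_synonym 'x word = "('x \<times> bool) list"

primrec word_eval :: "('g, 'm) monoid_scheme \<Rightarrow> ('x \<Rightarrow> 'g) \<Rightarrow> 'x word \<Rightarrow> 'g" where
  "word_eval G s [] = \<one>\<^bsub>G\<^esub>"
| "word_eval G s (l # w) =
     (if snd l then s (fst l) else inv\<^bsub>G\<^esub> (s (fst l))) \<otimes>\<^bsub>G\<^esub> word_eval G s w"

text \<open>Equality of words in the group presented by the relations \<open>l = r\<close>, for \<open>(l, r) \<in> R\<close>.\<close>

inductive presentation_eq :: "('x word \<times> 'x word) set \<Rightarrow> 'x word \<Rightarrow> 'x word \<Rightarrow> bool"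
  for R where
  refl: "presentation_eq R w w"
| sym: "presentation_eq R v w \<Longrightarrow> presentation_eq R w v"
| trans: "presentation_eq R u v \<Longrightarrow> presentation_eq R v w \<Longrightarrow> presentation_eq R u w"
| cancel: "presentation_eq R (u @ [(x, b), (x, \<not> b)] @ v) (u @ v)"
| relation: "(l, r) \<in> R \<Longrightarrow> presentation_eq R (u @ l @ v) (u @ r @ v)"

text \<open>\<open>G\<close> is the group presented by the generators \<open>s x\<close> (\<open>x\<close> ranging over the whole type
  \<open>'x\<close>) and the relations \<open>R\<close>: it is generated by them, and a word is trivial in \<open>G\<close>
  exactly if this follows from \<open>R\<close>.\<close>

definition has_presentation ::
  "('g, 'm) monoid_scheme \<Rightarrow> ('x \<Rightarrow> 'g) \<Rightarrow> ('x word \<times> 'x word) set \<Rightarrow> bool" where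
  "has_presentation G s R \<longleftrightarrow>
     group G \<and> range s \<subseteq> carrier G \<and> generate G (range s) = carrier G \<and>
     (\<forall>w. word_eval G s w = \<one>\<^bsub>G\<^esub> \<longleftrightarrow> presentation_eq R w [])"

datatype dihedral_gen = Sigma_gen | Tau_gen

definition dihedral_relations :: "nat \<Rightarrow> (dihedral_gen word \<times> dihedral_gen word) set" where
  "dihedral_relations n =
     {(replicate n (Sigma_gen, True), []),
      (replicate 2 (Tau_gen, True), []),
      ([(Tau_gen, True), (Sigma_gen, True), (Tau_gen, False)], [(Sigma_gen, False)])}"

definition dihedral_presentation ::
  "nat \<Rightarrow> ('g, 'm) monoid_scheme \<Rightarrow> 'g \<Rightarrow> 'g \<Rightarrow> bool" where
  "dihedral_presentation n G \<sigma> \<tau> \<longleftrightarrow>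
     has_presentation G (case_dihedral_gen \<sigma> \<tau>) (dihedral_relations n)"


section \<open>Modules over the integral group ring\<close>

text \<open>The elements of \<open>\<int>[G]\<close> are the finitely supported functions on \<open>carrier G\<close>;
  \<open>frag_of g\<close> is the basis element \<open>g\<close>, and \<open>frag_extend\<close> is \<open>\<int>\<close>-linear
  extension from basis elements.\<close>

definition group_ring :: "('g, 'm) monoid_scheme \<Rightarrow> ('g \<Rightarrow>\<^sub>0 int) ring" where
  "group_ring G =
     \<lparr>carrier = {a. Poly_Mapping.keys a \<subseteq> carrier G},
      monoid.mult = (\<lambda>a b. frag_extend (\<lambda>g. frag_extend (\<lambda>h. frag_of (g \<otimes>\<^bsub>G\<^esub> h)) b) a),
      one = frag_of \<one>\<^bsub>G\<^esub>,
      ring.zero = 0,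
      ring.add = (+)\<rparr>"

text \<open>The library's locale \<open>module\<close> assumes a commutative ring of scalars. The following
  has the same axioms over an arbitrary ring. As in the library, the fields
  \<open>mult\<close> and \<open>one\<close> of the module record play no role.\<close>

locale left_module = R?: ring R + M?: abelian_group M
  for R :: "('r, 'p) ring_scheme" and M :: "('r, 'b, 'q) module_scheme" (structure) +
  assumes smult_closed:
      "\<lbrakk>a \<in> carrier R; x \<in> carrier M\<rbrakk> \<Longrightarrow> a \<odot>\<^bsub>M\<^esub> x \<in> carrier M"
    and smult_l_distr:
      "\<lbrakk>a \<in> carrier R; b \<in> carrier R; x \<in> carrier M\<rbrakk> \<Longrightarrow>
       (a \<oplus>\<^bsub>R\<^esub> b) \<odot>\<^bsub>M\<^esub> x = a \<odot>\<^bsub>M\<^esub> x \<oplus>\<^bsub>M\<^esub> b \<odot>\<^bsub>M\<^esub> x"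
    and smult_r_distr:
      "\<lbrakk>a \<in> carrier R; x \<in> carrier M; y \<in> carrier M\<rbrakk> \<Longrightarrow>
       a \<odot>\<^bsub>M\<^esub> (x \<oplus>\<^bsub>M\<^esub> y) = a \<odot>\<^bsub>M\<^esub> x \<oplus>\<^bsub>M\<^esub> a \<odot>\<^bsub>M\<^esub> y"
    and smult_assoc1:
      "\<lbrakk>a \<in> carrier R; b \<in> carrier R; x \<in> carrier M\<rbrakk> \<Longrightarrow>
       (a \<otimes>\<^bsub>R\<^esub> b) \<odot>\<^bsub>M\<^esub> x = a \<odot>\<^bsub>M\<^esub> (b \<odot>\<^bsub>M\<^esub> x)"
    and smult_one:
      "x \<in> carrier M \<Longrightarrow> \<one>\<^bsub>R\<^esub> \<odot>\<^bsub>M\<^esub> x = x"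

definition finitely_generated_module ::
  "('r, 'p) ring_scheme \<Rightarrow> ('r, 'b, 'q) module_scheme \<Rightarrow> bool" where
  "finitely_generated_module R M \<longleftrightarrow>
     (\<exists>A. finite A \<and> A \<subseteq> carrier M \<and>
          (\<forall>H. submodule H R M \<and> A \<subseteq> H \<longrightarrow> H = carrier M))"

definition torsion_free :: "('b, 'q) ring_scheme \<Rightarrow> bool" where
  "torsion_free M \<longleftrightarrow>
     (\<forall>x\<in>carrier M. \<forall>k::int. k \<noteq> 0 \<longrightarrow> [k] \<cdot>\<^bsub>M\<^esub> x = \<zero>\<^bsub>M\<^esub> \<longrightarrow> x = \<zero>\<^bsub>M\<^esub>)"

definition module_iso ::
  "('r, 'p) ring_scheme \<Rightarrow> ('r, 'b, 'q) module_scheme \<Rightarrow> ('r, 'c, 's) module_scheme \<Rightarrow>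
   ('b \<Rightarrow> 'c) set" where
  "module_iso R M N =
     {f \<in> iso (add_monoid M) (add_monoid N).
        \<forall>a\<in>carrier R. \<forall>x\<in>carrier M. f (a \<odot>\<^bsub>M\<^esub> x) = a \<odot>\<^bsub>N\<^esub> f x}"

definition module_direct_sum ::
  "('r, 'b, 'q) module_scheme \<Rightarrow> ('r, 'c, 's) module_scheme \<Rightarrow> ('r, 'b \<times> 'c) module" where
  "module_direct_sum M N =
     \<lparr>carrier = carrier M \<times> carrier N,
      monoid.mult = (\<lambda>x y. (fst x \<otimes>\<^bsub>M\<^esub> fst y, snd x \<otimes>\<^bsub>N\<^esub> snd y)),
      one = (\<one>\<^bsub>M\<^esub>, \<one>\<^bsub>N\<^esub>),
      ring.zero = (\<zero>\<^bsub>M\<^esub>, \<zero>\<^bsub>N\<^esub>),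
      ring.add = (\<lambda>x y. (fst x \<oplus>\<^bsub>M\<^esub> fst y, snd x \<oplus>\<^bsub>N\<^esub> snd y)),
      smult = (\<lambda>a x. (a \<odot>\<^bsub>M\<^esub> fst x, a \<odot>\<^bsub>N\<^esub> snd x))\<rparr>"


section \<open>Lattices\<close>

definition G_lattice ::
  "('g, 'm) monoid_scheme \<Rightarrow> ('g \<Rightarrow>\<^sub>0 int, 'b, 'q) module_scheme \<Rightarrow> bool" where
  "G_lattice G M \<longleftrightarrow>
     left_module (group_ring G) M \<and> finitely_generated_module (group_ring G) M \<and> torsion_free M"

definition G_lattice_isomorphic ::
  "('g, 'm) monoid_scheme \<Rightarrow> ('g \<Rightarrow>\<^sub>0 int, 'b, 'q) module_scheme \<Rightarrow>
   ('g \<Rightarrow>\<^sub>0 int, 'c, 's) module_scheme \<Rightarrow> bool" where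
  "G_lattice_isomorphic G M N \<longleftrightarrow>
     G_lattice G M \<and> G_lattice G N \<and> module_iso (group_ring G) M N \<noteq> {}"

text \<open>The free abelian group on \<open>B\<close>, on which \<open>g\<close> acts by \<open>\<rho> g\<close>, with this action
  extended \<open>\<int>\<close>-linearly to \<open>\<int>[G]\<close>.\<close>

definition free_abelian_module ::
  "'b set \<Rightarrow> ('g \<Rightarrow> ('b \<Rightarrow>\<^sub>0 int) \<Rightarrow> ('b \<Rightarrow>\<^sub>0 int)) \<Rightarrow> ('g \<Rightarrow>\<^sub>0 int, 'b \<Rightarrow>\<^sub>0 int) module" where
  "free_abelian_module B \<rho> =
     \<lparr>carrier = carrier (free_Abelian_group B),
      monoid.mult = undefined,
      one = undefined,
      ring.zero = 0,
      ring.add = (+),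
      smult = (\<lambda>a m. frag_extend (\<lambda>g. \<rho> g m) a)\<rparr>"

text \<open>\<open>\<int>\<close> with trivial action: \<open>\<int>[G]\<close> acts through the sum of the coefficients.\<close>

definition trivial_lattice :: "('g \<Rightarrow>\<^sub>0 int, int) module" where
  "trivial_lattice =
     \<lparr>carrier = UNIV,
      monoid.mult = (*),
      one = 1,
      ring.zero = 0,
      ring.add = (+),
      smult = (\<lambda>a m. (\<Sum>g\<in>Poly_Mapping.keys a. Poly_Mapping.lookup a g) * m)\<rparr>"

text \<open>\<open>\<int>[G/S]\<close>: \<open>G\<close> permutes the basis of left cosets by left multiplication.\<close>

definition permutation_lattice ::
  "('g, 'm) monoid_scheme \<Rightarrow> 'g set \<Rightarrow> ('g \<Rightarrow>\<^sub>0 int, 'g set \<Rightarrow>\<^sub>0 int) module" where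
  "permutation_lattice G S =
     free_abelian_module (lcosets\<^bsub>G\<^esub> S) (\<lambda>g. frag_extend (\<lambda>C. frag_of (g <#\<^bsub>G\<^esub> C)))"


section \<open>The lattice $\widetilde{M}_+$\<close>

text \<open>\<open>Basis_x i\<close> is used for \<open>0 \<le> i < n\<close> only; it stands for \<open>x\<^sub>i\<close>.\<close>

datatype M_plus_basis = Basis_x int | Basis_w

definition M_plus_basis_set :: "nat \<Rightarrow> M_plus_basis set" where
  "M_plus_basis_set n = Basis_x ` {0..<int n} \<union> {Basis_w}"

definition M_plus_sigma ::
  "nat \<Rightarrow> (M_plus_basis \<Rightarrow>\<^sub>0 int) \<Rightarrow> (M_plus_basis \<Rightarrow>\<^sub>0 int)" where
  "M_plus_sigma n = frag_extend
     (case_M_plus_basis (\<lambda>i. frag_of (Basis_x ((i + 1) mod int n))) (frag_of Basis_w))"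

definition M_plus_tau ::
  "nat \<Rightarrow> (M_plus_basis \<Rightarrow>\<^sub>0 int) \<Rightarrow> (M_plus_basis \<Rightarrow>\<^sub>0 int)" where
  "M_plus_tau n = frag_extend
     (case_M_plus_basis (\<lambda>i. frag_of (Basis_x ((- i) mod int n)))
        (- frag_of Basis_w + (\<Sum>i\<in>{0..<int n}. frag_of (Basis_x i))))"

text \<open>The action of \<open>G\<close> on \<open>E\<close> in which \<open>\<sigma>\<close> acts by \<open>p\<close> and \<open>\<tau>\<close> by \<open>q\<close>. There is
  at most one if \<open>\<sigma>\<close> and \<open>\<tau>\<close> generate \<open>G\<close>, and one exists if \<open>p\<close> and \<open>q\<close>
  are permutations of \<open>E\<close> satisfying the defining relations of \<open>G\<close>. The restrictions are there because
  \<open>BijGroup E\<close>, the codomain of a \<open>group_action\<close>, consists of extensional functions.\<close>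

definition action_from_generators ::
  "('g, 'm) monoid_scheme \<Rightarrow> 'g \<Rightarrow> 'g \<Rightarrow> 'e set \<Rightarrow> ('e \<Rightarrow> 'e) \<Rightarrow> ('e \<Rightarrow> 'e) \<Rightarrow>
   'g \<Rightarrow> 'e \<Rightarrow> 'e" where
  "action_from_generators G \<sigma> \<tau> E p q =
     (THE \<rho>. \<rho> \<in> extensional (carrier G) \<and> group_action G E \<rho> \<and>
             \<rho> \<sigma> = restrict p E \<and> \<rho> \<tau> = restrict q E)"

definition M_plus ::
  "nat \<Rightarrow> ('g, 'm) monoid_scheme \<Rightarrow> 'g \<Rightarrow> 'g \<Rightarrow>
   ('g \<Rightarrow>\<^sub>0 int, M_plus_basis \<Rightarrow>\<^sub>0 int) module" where
  "M_plus n G \<sigma> \<tau> =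
     free_abelian_module (M_plus_basis_set n)
       (action_from_generators G \<sigma> \<tau> (carrier (free_Abelian_group (M_plus_basis_set n)))
          (M_plus_sigma n) (M_plus_tau n))"

end

theory Submission
  imports Defs
begin

text \<open>
  Write \<open>H\<close> for the subgroup generated by \<open>\<sigma>\<close>, \<open>e\<close> for the generator of the summand \<open>\<int>\<close>,
  \<open>X\<close> for the sum of the \<open>x\<^sub>i\<close>, and let \<open>c\<close> be an integer. In \<open>M\<^sub>+ \<oplus> \<int>\<close> (with \<open>M\<^sub>+\<close> for the lattice
  with basis \<open>x\<^sub>0, \<dots>, x\<^sub>n\<^sub>-\<^sub>1, w\<close>) the group permutes the vectors

    \<^item> \<open>x\<^sub>i + e\<close>, exactly as it permutes the cosets \<open>y\<^sub>i = \<sigma>\<^sup>i\<langle>\<tau>\<rangle>\<close>;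
    \<^item> \<open>w + c e\<close> and \<open>X - w + c e\<close>, which are fixed by \<open>\<sigma>\<close> and exchanged by \<open>\<tau>\<close>, exactly
      as it permutes the two cosets \<open>a\<^sub>0 = H\<close> and \<open>a\<^sub>1 = \<tau>H\<close>.

  Hence sending \<open>y\<^sub>i\<close>, \<open>a\<^sub>0\<close>, \<open>a\<^sub>1\<close> to these vectors is an equivariant map from the sum of the two
  permutation lattices to \<open>M\<^sub>+ \<oplus> \<int>\<close>, and the question is whether these \<open>n + 2\<close> vectors
  form a basis. The last two add up to \<open>X + 2 c e\<close> and the first \<open>n\<close> to \<open>X + n e\<close>, so the
  difference is \<open>(2 c - n) e\<close>. This is the point where \<open>n\<close> has to be odd: for \<open>c = (n + 1) / 2\<close> the
  difference is \<open>e\<close> itself, and then \<open>x\<^sub>i\<close> and \<open>w\<close> are recovered as well. Explicitly, with \<open>A = a\<^sub>0 + a\<^sub>1\<close>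
  and \<open>Y\<close> the sum of the \<open>y\<^sub>i\<close>, the inverse is
  \<open>e \<mapsto> A - Y\<close>, \<open>x\<^sub>i \<mapsto> y\<^sub>i - A + Y\<close>, \<open>w \<mapsto> a\<^sub>0 - c A + c Y\<close>. This inverse is the map
  \<open>lattice_iso\<close> below; that the two maps are mutually inverse is checked on basis vectors
  (\<open>from_to\<close>, \<open>to_from_rotations\<close>, \<open>to_from_tau\<close>), and so is the equivariance under \<open>\<sigma>\<close> and \<open>\<tau>\<close>, which
  implies \<open>\<int>[G]\<close>-linearity (\<open>group_ring_linear_if_generators\<close>).

  Two facts about the presented group \<open>G\<close> enter. First, an action of \<open>G\<close> on \<open>M\<^sub>+\<close> in which \<open>\<sigma>\<close>
  and \<open>\<tau>\<close> act by the given operators must exist. The operators satisfy the defining relations, so this action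
  is provided by von Dyck's theorem (\<open>von_Dyck\<close>). Second, \<open>G\<close> must not be smaller than expected: the
  cosets \<open>y\<^sub>0, \<dots>, y\<^sub>n\<^sub>-\<^sub>1\<close> are distinct, and so are \<open>a\<^sub>0\<close> and \<open>a\<^sub>1\<close>. Manipulating relations never
  shows that a word is nontrivial; this is seen in the same action, where the powers of \<open>\<sigma>\<close> with exponents
  \<open>0, \<dots>, n - 1\<close> move \<open>x\<^sub>0\<close> to different vectors, and every power of \<open>\<sigma>\<close> fixes \<open>w\<close> while \<open>\<tau>\<close> does not.
\<close>

section \<open>Finitely supported integer functions\<close>

lemma keys_frag_extend_subset:
  assumes "\<And>b. b \<in> Poly_Mapping.keys x \<Longrightarrow> Poly_Mapping.keys (f b) \<subseteq> C"
  shows "Poly_Mapping.keys (frag_extend f x) \<subseteq> C"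
  using keys_frag_extend [of f x] UN_least [OF assms] by (rule order_trans)

lemma frag_extend_add_fun:
  "frag_extend (\<lambda>b. f b + h b) x = frag_extend f x + frag_extend h x"
  by (simp add: frag_extend_def frag_cmul_distrib2 sum.distrib)

lemma frag_cmul_closed: "Poly_Mapping.keys x \<subseteq> B \<Longrightarrow> Poly_Mapping.keys (frag_cmul k x) \<subseteq> B"
  using keys_cmul [of k x] by blast

lemma frag_add_closed:
  "\<lbrakk>Poly_Mapping.keys x \<subseteq> B; Poly_Mapping.keys y \<subseteq> B\<rbrakk> \<Longrightarrow> Poly_Mapping.keys (x + y) \<subseteq> B"
  using keys_add [of x y] by blast

lemma frag_diff_closed:
  "\<lbrakk>Poly_Mapping.keys x \<subseteq> B; Poly_Mapping.keys y \<subseteq> B\<rbrakk> \<Longrightarrow> Poly_Mapping.keys (x - y) \<subseteq> B"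
  using keys_diff [of x y] by blast

lemma sum_int_interval_const_frag: "(\<Sum>i\<in>{0..<int n}. x) = frag_cmul (int n) x"
  by (rule poly_mapping_eqI) (simp add: lookup_sum)

text \<open>Identities between integer combinations of a few fixed vectors become linear integer
  arithmetic once they are read coefficientwise.\<close>

lemmas frag_pointwise = poly_mapping_eq_iff fun_eq_iff lookup_add lookup_minus

definition augmentation :: "('b \<Rightarrow>\<^sub>0 int) \<Rightarrow> int" where
  "augmentation a = (\<Sum>b\<in>Poly_Mapping.keys a. Poly_Mapping.lookup a b)"

text \<open>Collapsing all basis elements to one point turns the sum of the coefficients into the only
  coefficient of a linear extension, so that its additivity is inherited from \<open>frag_extend\<close>.\<close>

lemma augmentation_eq_lookup:
  "augmentation a = Poly_Mapping.lookup (frag_extend (\<lambda>_. frag_of ()) a) ()"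
  by (simp add: augmentation_def frag_extend_def lookup_sum)

lemma augmentation_0 [simp]: "augmentation 0 = 0"
  and augmentation_frag_of [simp]: "augmentation (frag_of b) = 1"
  and augmentation_add: "augmentation (x + y) = augmentation x + augmentation y"
  and augmentation_diff: "augmentation (x - y) = augmentation x - augmentation y"
  by (simp_all add: augmentation_eq_lookup frag_extend_add frag_extend_diff lookup_add lookup_minus)

lemma augmentation_sum: "augmentation (sum f I) = (\<Sum>i\<in>I. augmentation (f i))"
  by (induction I rule: infinite_finite_induct) (simp_all add: augmentation_add)

lemma augmentation_mult:
  "augmentation (frag_extend (\<lambda>g. frag_extend (\<lambda>h. frag_of (f g h)) b) a) =
    augmentation a * augmentation b"
proof -
  have inner: "augmentation (frag_extend (\<lambda>h. frag_of (f g h)) b) = augmentation b" for g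
    using subset_UNIV [of "Poly_Mapping.keys b"]
    by (induction rule: frag_induction) (simp_all add: frag_extend_diff augmentation_diff)
  show ?thesis
    using subset_UNIV [of "Poly_Mapping.keys a"]
    by (induction rule: frag_induction)
      (simp_all add: frag_extend_diff augmentation_diff inner algebra_simps)
qed

lemma augmentation_cmul: "augmentation (frag_cmul k u) = k * augmentation u"
  by (simp add: augmentation_eq_lookup frag_extend_cmul)

lemma augmentation_uminus: "augmentation (- u) = - augmentation u"
  using augmentation_diff [of 0 u] by simp

section \<open>Homomorphisms out of a presented group\<close>

text \<open>Words form only a monoid; the formal inverse supplies the words by which equality of two
  values is reduced to the triviality of one word.\<close>

definition inverse_word :: "'x word \<Rightarrow> 'x word" where
  "inverse_word w = rev (map (\<lambda>(x, b). (x, \<not> b)) w)"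

lemma inverse_word_Nil [simp]: "inverse_word [] = []"
  and inverse_word_Cons [simp]: "inverse_word (l # w) = inverse_word w @ [(fst l, \<not> snd l)]"
  by (auto simp: inverse_word_def split: prod.splits)

lemma (in group) word_eval_closed:
  assumes "range s \<subseteq> carrier G"
  shows "word_eval G s w \<in> carrier G"
  using assms by (induction w) auto

lemma (in group) word_eval_append:
  assumes "range s \<subseteq> carrier G"
  shows "word_eval G s (v @ w) = word_eval G s v \<otimes> word_eval G s w"
  using assms
proof (induction v)
  case (Cons l v)
  moreover have "s (fst l) \<in> carrier G"
    using Cons by auto
  ultimately show ?case
    by (simp add: word_eval_closed m_assoc)
qed (simp add: word_eval_closed)

lemma (in group) word_eval_inverse_word:
  assumes "range s \<subseteq> carrier G"
  shows "word_eval G s (inverse_word w) = inv (word_eval G s w)"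
  using assms
proof (induction w)
  case (Cons l w)
  moreover have "s (fst l) \<in> carrier G"
    using Cons by auto
  ultimately show ?case
    by (simp add: word_eval_closed word_eval_append inv_mult_group)
qed simp

lemma (in group) generate_imp_word_eval:
  assumes s: "range s \<subseteq> carrier G" and "g \<in> generate G (range s)"
  shows "\<exists>w. word_eval G s w = g"
  using assms(2)
proof (induction rule: generate.induct)
  case one
  show ?case by (rule exI [of _ "[]"]) simp
next
  case (incl h)
  then obtain x where "h = s x" by blast
  moreover have "s x \<in> carrier G" using s by auto
  ultimately have "word_eval G s [(x, True)] = h" by simp
  then show ?case ..
next
  case (inv h)
  then obtain x where "h = s x" by blast
  moreover have "s x \<in> carrier G" using s by auto
  ultimately have "word_eval G s [(x, False)] = inv h" by simp
  then show ?case ..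
next
  case (eng g h)
  then obtain v w where "word_eval G s v = g" "word_eval G s w = h" by blast
  then have "word_eval G s (v @ w) = g \<otimes> h" by (simp add: word_eval_append s)
  then show ?case ..
qed

lemma (in group) word_eval_respects_presentation_eq:
  assumes s: "range s \<subseteq> carrier G"
    and rel: "\<And>l r. (l, r) \<in> R \<Longrightarrow> word_eval G s l = word_eval G s r"
    and "presentation_eq R v w"
  shows "word_eval G s v = word_eval G s w"
  using assms(3)
proof induction
  case (cancel u x b v)
  have "s x \<in> carrier G" using s by auto
  then have "word_eval G s [(x, b), (x, \<not> b)] = \<one>"
    by (cases b) simp_all
  then show ?case
    by (simp only: word_eval_append [OF s]) (simp add: word_eval_closed [OF s])
qed (simp_all add: word_eval_append [OF s] rel)

text \<open>Every element of \<open>G\<close> is the value of a word, and the homomorphism has to map it to the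
  value of the same word in \<open>H\<close>. The choice of the word does not matter: if \<open>v\<close> and \<open>w\<close> have the same
  value in \<open>G\<close>, then \<open>v w\<inverse>\<close> is trivial there, hence trivial by the relations alone, and the relations
  hold in \<open>H\<close> as well.\<close>

lemma von_Dyck:
  assumes pres: "has_presentation G s R" and "group H" and t: "range t \<subseteq> carrier H"
    and rel: "\<And>l r. (l, r) \<in> R \<Longrightarrow> word_eval H t l = word_eval H t r"
  obtains h where "h \<in> hom G H" "\<And>x. h (s x) = t x"
proof -
  interpret G: group G using pres by (simp add: has_presentation_def)
  interpret H: group H by fact
  have s: "range s \<subseteq> carrier G" and gen: "generate G (range s) = carrier G"
    and triv: "\<And>w. word_eval G s w = \<one>\<^bsub>G\<^esub> \<longleftrightarrow> presentation_eq R w []"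
    using pres by (auto simp: has_presentation_def)
  have wd: "word_eval H t v = word_eval H t w" if "word_eval G s v = word_eval G s w" for v w
  proof -
    have "word_eval G s (v @ inverse_word w) = \<one>\<^bsub>G\<^esub>"
      using that by (simp add: G.word_eval_append G.word_eval_inverse_word G.word_eval_closed s)
    then have "word_eval H t (v @ inverse_word w) = word_eval H t []"
      using triv H.word_eval_respects_presentation_eq [OF t rel] by blast
    then have "word_eval H t v \<otimes>\<^bsub>H\<^esub> inv\<^bsub>H\<^esub> word_eval H t w = \<one>\<^bsub>H\<^esub>"
      by (simp add: H.word_eval_append H.word_eval_inverse_word t)
    then show ?thesis
      by (metis H.inv_closed H.inv_equality H.inv_inv H.word_eval_closed t)
  qed
  define h where "h g = word_eval H t (SOME w. word_eval G s w = g)" for g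
  have h: "h (word_eval G s w) = word_eval H t w" for w
    unfolding h_def by (rule wd) (rule someI [of _ w], rule HOL.refl)
  show ?thesis
  proof
    show "h \<in> hom G H"
    proof (rule homI)
      fix x y assume "x \<in> carrier G" "y \<in> carrier G"
      then obtain v w where "word_eval G s v = x" "word_eval G s w = y"
        using G.generate_imp_word_eval [OF s] gen by blast
      then show "h (x \<otimes>\<^bsub>G\<^esub> y) = h x \<otimes>\<^bsub>H\<^esub> h y"
        by (metis h G.word_eval_append H.word_eval_append s t)
    qed (simp add: h_def H.word_eval_closed t)
    show "h (s x) = t x" for x
    proof -
      have "s x \<in> carrier G" "t x \<in> carrier H" using s t by auto
      then show ?thesis using h [of "[(x, True)]"] by simp
    qed
  qed
qed

lemma (in group) word_eval_replicate:
  assumes "s x \<in> carrier G"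
  shows "word_eval G s (replicate k (x, True)) = s x [^] k"
proof (induction k)
  case (Suc k)
  then show ?case
    using nat_pow_mult [OF assms, of 1 k] assms by simp
qed simp

section \<open>Actions prescribed on generators\<close>

lemma (in group) homs_agree_on_generated:
  assumes "group H" and f: "f \<in> hom G H" and h: "h \<in> hom G H" and S: "S \<subseteq> carrier G"
    and eq: "\<And>x. x \<in> S \<Longrightarrow> f x = h x" and "x \<in> generate G S"
  shows "f x = h x"
proof -
  interpret f: group_hom G H f using assms by (simp add: group_hom_def group_hom_axioms_def)
  interpret h: group_hom G H h using assms by (simp add: group_hom_def group_hom_axioms_def)
  show ?thesis using \<open>x \<in> generate G S\<close>
  proof induction
    case (inv x)
    then have "x \<in> carrier G" using S by blast
    then show ?case using inv by (simp add: eq)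
  next
    case (eng x y)
    then have "x \<in> carrier G" "y \<in> carrier G" using generate_in_carrier [OF S] by auto
    then show ?case using eng by simp
  qed (simp_all add: eq)
qed

text \<open>The definite description defining the action denotes something because a group
  homomorphism is determined by its values on generators; it suffices to exhibit one action.\<close>

lemma action_from_generators_properties:
  fixes G (structure)
  assumes "group_action G E \<rho>" and gen: "generate G {\<sigma>, \<tau>} = carrier G"
    and "\<rho> \<sigma> = restrict p E" "\<rho> \<tau> = restrict q E"
  shows "group_action G E (action_from_generators G \<sigma> \<tau> E p q)"
    and "action_from_generators G \<sigma> \<tau> E p q \<sigma> = restrict p E"
    and "action_from_generators G \<sigma> \<tau> E p q \<tau> = restrict q E"
proof -
  interpret \<rho>: group_action G E \<rho> by fact
  interpret group_hom G "BijGroup E" \<rho> by (rule \<rho>.group_hom)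
  have mem: "\<sigma> \<in> carrier G" "\<tau> \<in> carrier G"
    using gen generate.incl [of _ "{\<sigma>, \<tau>}" G] by auto
  let ?P = "\<lambda>\<rho>. \<rho> \<in> extensional (carrier G) \<and> group_action G E \<rho> \<and>
             \<rho> \<sigma> = restrict p E \<and> \<rho> \<tau> = restrict q E"
  have ex: "?P (restrict \<rho> (carrier G))"
  proof -
    have "restrict \<rho> (carrier G) \<in> hom G (BijGroup E)"
      by (rule homI) simp_all
    then show ?thesis using assms mem
      by (simp add: group_action_def group_hom_def group_hom_axioms_def group_BijGroup)
  qed
  have uniq: "\<alpha> = \<beta>" if \<alpha>: "?P \<alpha>" and \<beta>: "?P \<beta>" for \<alpha> \<beta>
  proof (rule extensionalityI [of _ "carrier G"])
    have homs: "\<alpha> \<in> hom G (BijGroup E)" "\<beta> \<in> hom G (BijGroup E)"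
      using \<alpha> \<beta> by (auto simp: group_action_def group_hom_def group_hom_axioms_def)
    have "\<alpha> x = \<beta> x" if "x \<in> {\<sigma>, \<tau>}" for x
      using \<alpha> \<beta> that by auto
    moreover fix g assume "g \<in> carrier G"
    ultimately show "\<alpha> g = \<beta> g"
      using G.homs_agree_on_generated [OF group_BijGroup homs, of "{\<sigma>, \<tau>}"] mem gen by simp
  qed (use that in auto)
  have "?P (action_from_generators G \<sigma> \<tau> E p q)"
    unfolding action_from_generators_def using theI [of ?P, OF ex uniq [OF _ ex]] by blast
  then show "group_action G E (action_from_generators G \<sigma> \<tau> E p q)"
    and "action_from_generators G \<sigma> \<tau> E p q \<sigma> = restrict p E"
    and "action_from_generators G \<sigma> \<tau> E p q \<tau> = restrict q E"
    by blast+
qed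

lemma BijGroup_mult_restrict:
  assumes "restrict f E \<in> carrier (BijGroup E)" "restrict h E \<in> carrier (BijGroup E)"
  shows "restrict f E \<otimes>\<^bsub>BijGroup E\<^esub> restrict h E = restrict (f \<circ> h) E"
proof -
  have "h x \<in> E" if "x \<in> E" for x
    using funcset_mem [OF Bij_imp_funcset, of "restrict h E" E x] assms(2) that
    by (simp add: BijGroup_def)
  then show ?thesis
    using assms by (auto simp: BijGroup_def compose_def restrict_def)
qed

lemma BijGroup_pow_restrict:
  assumes "restrict f E \<in> carrier (BijGroup E)"
  shows "restrict f E [^]\<^bsub>BijGroup E\<^esub> (k::nat) = restrict (f ^^ k) E"
proof -
  interpret group "BijGroup E" by (rule group_BijGroup)
  show ?thesis
  proof (induction k)
    case 0
    then show ?case by (simp add: BijGroup_def id_def)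
  next
    case (Suc k)
    then have "restrict (f ^^ k) E \<in> carrier (BijGroup E)"
      by (metis assms nat_pow_closed)
    from BijGroup_mult_restrict [OF this assms] show ?case
      by (simp only: nat_pow_Suc Suc funpow_Suc_right)
  qed
qed

lemma restrict_in_BijGroup:
  assumes "\<And>x. x \<in> E \<Longrightarrow> f x \<in> E" "\<And>x. x \<in> E \<Longrightarrow> h x \<in> E"
    and "\<And>x. x \<in> E \<Longrightarrow> h (f x) = x" "\<And>x. x \<in> E \<Longrightarrow> f (h x) = x"
  shows "restrict f E \<in> carrier (BijGroup E)"
proof -
  have "bij_betw f E E"
    by (rule bij_betw_byWitness [of _ h]) (use assms in auto)
  then show ?thesis
    by (simp add: BijGroup_def Bij_def cong: bij_betw_cong)
qed

section \<open>Lattices from linear actions\<close>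

lemma free_abelian_module_simps:
  "carrier (free_abelian_module B \<rho>) = {x. Poly_Mapping.keys x \<subseteq> B}"
  "ring.zero (free_abelian_module B \<rho>) = 0"
  "ring.add (free_abelian_module B \<rho>) = (+)"
  "a \<odot>\<^bsub>free_abelian_module B \<rho>\<^esub> x = frag_extend (\<lambda>g. \<rho> g x) a"
  by (auto simp: free_abelian_module_def)

text \<open>Additivity and the action laws are required only on the free abelian group on \<open>B\<close>:
  the operators of a \<open>group_action\<close> are extensional functions, so they carry no information elsewhere.\<close>

locale linear_action = group G for G (structure) +
  fixes B :: "'e set" and \<rho> :: "'a \<Rightarrow> ('e \<Rightarrow>\<^sub>0 int) \<Rightarrow> ('e \<Rightarrow>\<^sub>0 int)"
  assumes act_closed:
      "\<lbrakk>g \<in> carrier G; Poly_Mapping.keys x \<subseteq> B\<rbrakk> \<Longrightarrow> Poly_Mapping.keys (\<rho> g x) \<subseteq> B"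
    and act_add: "\<lbrakk>g \<in> carrier G; Poly_Mapping.keys x \<subseteq> B; Poly_Mapping.keys y \<subseteq> B\<rbrakk> \<Longrightarrow>
        \<rho> g (x + y) = \<rho> g x + \<rho> g y"
    and act_one: "Poly_Mapping.keys x \<subseteq> B \<Longrightarrow> \<rho> \<one> x = x"
    and act_mult: "\<lbrakk>g \<in> carrier G; h \<in> carrier G; Poly_Mapping.keys x \<subseteq> B\<rbrakk> \<Longrightarrow>
        \<rho> (g \<otimes> h) x = \<rho> g (\<rho> h x)"
begin

abbreviation scalar :: "('a \<Rightarrow>\<^sub>0 int) \<Rightarrow> ('e \<Rightarrow>\<^sub>0 int) \<Rightarrow> ('e \<Rightarrow>\<^sub>0 int)" where
  "scalar a x \<equiv> frag_extend (\<lambda>g. \<rho> g x) a"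

lemma scalar_closed:
  assumes "Poly_Mapping.keys a \<subseteq> carrier G" "Poly_Mapping.keys x \<subseteq> B"
  shows "Poly_Mapping.keys (scalar a x) \<subseteq> B"
  by (rule keys_frag_extend_subset) (rule act_closed [OF subsetD [OF assms(1)] assms(2)])

lemma act_0: "g \<in> carrier G \<Longrightarrow> \<rho> g 0 = 0"
  using act_add [of g 0 0] by simp

lemma act_diff:
  assumes "g \<in> carrier G" "Poly_Mapping.keys x \<subseteq> B" "Poly_Mapping.keys y \<subseteq> B"
  shows "\<rho> g (x - y) = \<rho> g x - \<rho> g y"
proof -
  have "Poly_Mapping.keys (x - y) \<subseteq> B"
    using keys_diff [of x y] assms by blast
  then show ?thesis
    using act_add [of g "x - y" y] assms by simp
qed

lemma scalar_add_right:
  assumes "Poly_Mapping.keys a \<subseteq> carrier G" "Poly_Mapping.keys x \<subseteq> B" "Poly_Mapping.keys y \<subseteq> B"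
  shows "scalar a (x + y) = scalar a x + scalar a y"
  using assms(1)
  by (induction rule: frag_induction) (simp_all add: frag_extend_diff act_add assms)

lemma act_scalar:
  assumes "g \<in> carrier G" "Poly_Mapping.keys a \<subseteq> carrier G" "Poly_Mapping.keys x \<subseteq> B"
  shows "scalar (frag_extend (\<lambda>h. frag_of (g \<otimes> h)) a) x = \<rho> g (scalar a x)"
proof -
  have "Poly_Mapping.keys a \<subseteq> carrier G \<and>
      scalar (frag_extend (\<lambda>h. frag_of (g \<otimes> h)) a) x = \<rho> g (scalar a x)"
    using assms(2)
  proof (induction rule: frag_induction)
    case (diff a b)
    moreover have "Poly_Mapping.keys (a - b) \<subseteq> carrier G"
      using diff keys_diff [of a b] by (meson Un_least order_trans)
    ultimately show ?case
      by (simp add: frag_extend_diff act_diff assms scalar_closed)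
  qed (simp_all add: act_0 act_mult assms)
  then show ?thesis ..
qed

lemma scalar_assoc:
  assumes "Poly_Mapping.keys a \<subseteq> carrier G" "Poly_Mapping.keys b \<subseteq> carrier G"
    "Poly_Mapping.keys x \<subseteq> B"
  shows "scalar (frag_extend (\<lambda>g. frag_extend (\<lambda>h. frag_of (g \<otimes> h)) b) a) x = scalar a (scalar b x)"
  using assms(1)
  by (induction rule: frag_induction) (simp_all add: frag_extend_diff act_scalar assms)

end

text \<open>The product of the group ring is the scalar action of \<open>\<int>[G]\<close> on itself that comes from left
  translation. The ring laws are therefore instances of the module laws, except for the right unit.\<close>

lemma (in group) linear_action_regular:
  "linear_action G (carrier G) (\<lambda>g. frag_extend (\<lambda>h. frag_of (g \<otimes> h)))"
proof
  fix g h and x y :: "'a \<Rightarrow>\<^sub>0 int"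
  assume gh: "g \<in> carrier G" and x: "Poly_Mapping.keys x \<subseteq> carrier G"
  show "Poly_Mapping.keys (frag_extend (\<lambda>h. frag_of (g \<otimes> h)) x) \<subseteq> carrier G"
    by (rule keys_frag_extend_subset) (use gh x in auto)
  show "frag_extend (\<lambda>h. frag_of (g \<otimes> h)) (x + y) =
      frag_extend (\<lambda>h. frag_of (g \<otimes> h)) x + frag_extend (\<lambda>h. frag_of (g \<otimes> h)) y"
    by (rule frag_extend_add)
  assume h: "h \<in> carrier G"
  show "frag_extend (\<lambda>k. frag_of (g \<otimes> h \<otimes> k)) x =
      frag_extend (\<lambda>k. frag_of (g \<otimes> k)) (frag_extend (\<lambda>k. frag_of (h \<otimes> k)) x)"
    using x by (induction rule: frag_induction) (simp_all add: frag_extend_diff gh h m_assoc)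
next
  fix x :: "'a \<Rightarrow>\<^sub>0 int"
  assume "Poly_Mapping.keys x \<subseteq> carrier G"
  then show "frag_extend (\<lambda>h. frag_of (\<one> \<otimes> h)) x = x"
    by (induction rule: frag_induction) (simp_all add: frag_extend_diff)
qed

lemma abelian_group_frags:
  assumes "carrier M = {x. Poly_Mapping.keys x \<subseteq> B}" "ring.zero M = 0" "ring.add M = (+)"
  shows "abelian_group (M :: ('b \<Rightarrow>\<^sub>0 int, 'q) ring_scheme)"
proof (rule abelian_groupI)
  fix x :: "'b \<Rightarrow>\<^sub>0 int" assume "x \<in> carrier M"
  then show "\<exists>y\<in>carrier M. y \<oplus>\<^bsub>M\<^esub> x = \<zero>\<^bsub>M\<^esub>"
    using assms by (intro bexI [of _ "- x"]) auto
qed (use assms in \<open>auto simp: algebra_simps dest: subsetD [OF keys_add]\<close>)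

lemma (in group) ring_group_ring: "ring (group_ring G)"
proof -
  interpret reg: linear_action G "carrier G" "\<lambda>g. frag_extend (\<lambda>h. frag_of (g \<otimes> h))"
    by (rule linear_action_regular)
  have one: "frag_extend (\<lambda>g. frag_of (g \<otimes> \<one>)) x = x" if "Poly_Mapping.keys x \<subseteq> carrier G" for x
    using that by (induction rule: frag_induction) (simp_all add: frag_extend_diff)
  show ?thesis
  proof (rule ringI)
    show "abelian_group (group_ring G)"
      by (rule abelian_group_frags [where B = "carrier G"]) (simp_all add: group_ring_def)
    show "monoid (group_ring G)"
      by (rule monoidI)
        (simp_all add: group_ring_def reg.scalar_closed reg.scalar_assoc reg.act_one one)
  qed (simp_all add: group_ring_def frag_extend_add frag_extend_add_fun)
qed

lemma left_moduleI:
  assumes "ring R" "abelian_group M"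
    and "\<And>a x. \<lbrakk>a \<in> carrier R; x \<in> carrier M\<rbrakk> \<Longrightarrow> a \<odot>\<^bsub>M\<^esub> x \<in> carrier M"
    and "\<And>a b x. \<lbrakk>a \<in> carrier R; b \<in> carrier R; x \<in> carrier M\<rbrakk> \<Longrightarrow>
       (a \<oplus>\<^bsub>R\<^esub> b) \<odot>\<^bsub>M\<^esub> x = a \<odot>\<^bsub>M\<^esub> x \<oplus>\<^bsub>M\<^esub> b \<odot>\<^bsub>M\<^esub> x"
    and "\<And>a x y. \<lbrakk>a \<in> carrier R; x \<in> carrier M; y \<in> carrier M\<rbrakk> \<Longrightarrow>
       a \<odot>\<^bsub>M\<^esub> (x \<oplus>\<^bsub>M\<^esub> y) = a \<odot>\<^bsub>M\<^esub> x \<oplus>\<^bsub>M\<^esub> a \<odot>\<^bsub>M\<^esub> y"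
    and "\<And>a b x. \<lbrakk>a \<in> carrier R; b \<in> carrier R; x \<in> carrier M\<rbrakk> \<Longrightarrow>
       (a \<otimes>\<^bsub>R\<^esub> b) \<odot>\<^bsub>M\<^esub> x = a \<odot>\<^bsub>M\<^esub> (b \<odot>\<^bsub>M\<^esub> x)"
    and "\<And>x. x \<in> carrier M \<Longrightarrow> \<one>\<^bsub>R\<^esub> \<odot>\<^bsub>M\<^esub> x = x"
  shows "left_module R M"
  using assms by (simp add: left_module_def left_module_axioms_def)

lemma (in linear_action) left_module_free:
  "left_module (group_ring G) (free_abelian_module B \<rho>)"
proof (rule left_moduleI)
  show "abelian_group (free_abelian_module B \<rho>)"
    by (rule abelian_group_frags [where B = B]) (auto simp: free_abelian_module_simps)
qed (simp_all add: ring_group_ring, simp_all add: free_abelian_module_simps group_ring_def frag_extend_add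
      scalar_closed scalar_assoc scalar_add_right act_one)

text \<open>Integer multiples in the additive group of a module are computed in a group where a formula for them
  is known.\<close>

lemma hom_add_pow_int:
  assumes "abelian_group M" "group N" "f \<in> hom (add_monoid M) N" "x \<in> carrier M"
  shows "f (add_pow M (k::int) x) = f x [^]\<^bsub>N\<^esub> k"
proof -
  interpret abelian_group M by fact
  show ?thesis
    unfolding add_pow_def
    using hom_int_pow [OF assms(3) _ a_group assms(2), of x k] assms by simp
qed

lemma (in linear_action) torsion_free_free: "torsion_free (free_abelian_module B \<rho>)"
  unfolding torsion_free_def
proof (intro ballI allI impI)
  let ?M = "free_abelian_module B \<rho>"
  interpret left_module "group_ring G" ?M by (rule left_module_free)
  fix x and k :: int
  assume x: "x \<in> carrier ?M" and k: "k \<noteq> 0" and 0: "add_pow ?M k x = \<zero>\<^bsub>?M\<^esub>"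
  have "id \<in> hom (add_monoid ?M) (free_Abelian_group B)"
    by (auto simp: hom_def free_abelian_module_simps)
  from hom_add_pow_int [OF M.abelian_group_axioms _ this x, of k] 0 x
  have "frag_cmul k x = 0"
    by (simp add: free_abelian_module_simps)
  then show "x = \<zero>\<^bsub>?M\<^esub>"
    using k by (simp add: free_abelian_module_simps)
qed

lemma (in linear_action) finitely_generated_free:
  assumes "finite B"
  shows "finitely_generated_module (group_ring G) (free_abelian_module B \<rho>)"
  unfolding finitely_generated_module_def
proof (intro exI [of _ "frag_of ` B"] conjI allI impI)
  let ?M = "free_abelian_module B \<rho>"
  interpret left_module "group_ring G" ?M by (rule left_module_free)
  show "frag_of ` B \<subseteq> carrier ?M"
    by (auto simp: free_abelian_module_simps)
  fix H assume H: "submodule H (group_ring G) ?M \<and> frag_of ` B \<subseteq> H"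
  then interpret H: subgroup H "add_monoid ?M" by (simp add: submodule_def)
  have H_sub: "Poly_Mapping.keys x \<subseteq> B" if "x \<in> H" for x
    using H.subset that by (auto simp: free_abelian_module_simps)
  have inv: "inv\<^bsub>add_monoid ?M\<^esub> x = - x" if "x \<in> H" for x
    using M.minus_equality [of "- x" x] H_sub [OF that] by (simp add: a_inv_def free_abelian_module_simps)
  have "x \<in> H" if "Poly_Mapping.keys x \<subseteq> B" for x
    using that
  proof (induction rule: frag_induction)
    case (diff a b)
    then have "a + (- b) \<in> H"
      using H.m_closed [of a "- b"] H.m_inv_closed [of b] inv by (simp add: free_abelian_module_simps)
    then show ?case by simp
  qed (use H H.one_closed in \<open>auto simp: free_abelian_module_simps\<close>)
  with H_sub show "H = carrier ?M"
    by (auto simp: free_abelian_module_simps)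
qed (use assms in auto)

lemma (in linear_action) G_lattice_free:
  "finite B \<Longrightarrow> G_lattice G (free_abelian_module B \<rho>)"
  by (simp add: G_lattice_def left_module_free finitely_generated_free torsion_free_free)

text \<open>The elements of \<open>G\<close> that act additively form a subgroup.\<close>

lemma linear_action_if_generators:
  fixes G (structure)
  assumes "group_action G {x. Poly_Mapping.keys x \<subseteq> B} \<rho>"
    and S: "S \<subseteq> carrier G" "generate G S = carrier G"
    and add: "\<And>g x y. \<lbrakk>g \<in> S; Poly_Mapping.keys x \<subseteq> B; Poly_Mapping.keys y \<subseteq> B\<rbrakk> \<Longrightarrow>
        \<rho> g (x + y) = \<rho> g x + \<rho> g y"
  shows "linear_action G B \<rho>"
proof -
  let ?E = "{x :: _ \<Rightarrow>\<^sub>0 int. Poly_Mapping.keys x \<subseteq> B}"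
  interpret action: group_action G ?E \<rho> by fact
  interpret hom: group_hom G "BijGroup ?E" \<rho> by (rule action.group_hom)
  have add_closed: "x + y \<in> ?E" if "x \<in> ?E" "y \<in> ?E" for x y
    using that keys_add [of x y] by blast
  have closed: "\<rho> g x \<in> ?E" if "g \<in> carrier G" "x \<in> ?E" for g x
    using action.element_image that by blast
  have act_one: "\<rho> \<one> x = x" if "x \<in> ?E" for x
    using fun_cong [OF action.id_eq_one, of x] that by simp
  have "\<forall>x\<in>?E. \<forall>y\<in>?E. \<rho> g (x + y) = \<rho> g x + \<rho> g y" if "g \<in> generate G S" for g
    using that
  proof induction
    case one
    show ?case
      using act_one add_closed by (auto simp del: hom.hom_one)
  next
    case (incl g)
    then show ?case using add by simp
  next
    case (inv g)
    then have g: "g \<in> carrier G" using S by blast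
    show ?case
    proof (intro ballI)
      fix x y assume x: "x \<in> ?E" and y: "y \<in> ?E"
      define x' y' where "x' = \<rho> (inv g) x" and "y' = \<rho> (inv g) y"
      have mem: "x' \<in> ?E" "y' \<in> ?E"
        unfolding x'_def y'_def using closed [of "inv g"] g x y by blast+
      have "\<rho> g x' = x"
        using action.orbit_sym_aux [of "inv g" x x'] g x by (simp add: x'_def)
      moreover have "\<rho> g y' = y"
        using action.orbit_sym_aux [of "inv g" y y'] g y by (simp add: y'_def)
      ultimately have "\<rho> g (x' + y') = x + y"
        using add [OF inv] mem by simp
      from action.orbit_sym_aux [OF g add_closed [OF mem] this]
      show "\<rho> (inv g) (x + y) = \<rho> (inv g) x + \<rho> (inv g) y"
        unfolding x'_def y'_def .
    qed
  next
    case (eng g h)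
    then have "g \<in> carrier G" "h \<in> carrier G" using S by auto
    then show ?case
      using eng closed add_closed
      by (auto simp: action.composition_rule simp del: hom.hom_mult)
  qed
  then show ?thesis
    using S closed act_one action.composition_rule
    by unfold_locales (auto simp del: hom.hom_one)
qed

lemma (in group) linear_action_cosets:
  assumes "subgroup H G"
  shows "linear_action G (lcosets H) (\<lambda>g. frag_extend (\<lambda>C. frag_of (g <# C)))"
proof
  have sub: "C \<subseteq> carrier G" if "C \<in> lcosets H" for C
    using lcosets_subset_PowG [OF assms] that by blast
  have coset: "g <# C \<in> lcosets H" if "g \<in> carrier G" "C \<in> lcosets H" for g C
    using that lcos_m_assoc [OF subgroup.subset [OF assms]] by (auto simp: LCOSETS_def)
  fix g h and x y :: "'a set \<Rightarrow>\<^sub>0 int"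
  assume g: "g \<in> carrier G" and x: "Poly_Mapping.keys x \<subseteq> lcosets H"
  show "Poly_Mapping.keys (frag_extend (\<lambda>C. frag_of (g <# C)) x) \<subseteq> lcosets H"
    by (rule keys_frag_extend_subset) (use g x coset in auto)
  show "frag_extend (\<lambda>C. frag_of (g <# C)) (x + y) =
      frag_extend (\<lambda>C. frag_of (g <# C)) x + frag_extend (\<lambda>C. frag_of (g <# C)) y"
    by (rule frag_extend_add)
  assume h: "h \<in> carrier G"
  show "frag_extend (\<lambda>C. frag_of (g \<otimes> h <# C)) x =
      frag_extend (\<lambda>C. frag_of (g <# C)) (frag_extend (\<lambda>C. frag_of (h <# C)) x)"
    using x by (induction rule: frag_induction)
      (simp_all add: frag_extend_diff lcos_m_assoc g h sub)
next
  fix x :: "'a set \<Rightarrow>\<^sub>0 int"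
  assume "Poly_Mapping.keys x \<subseteq> lcosets H"
  then show "frag_extend (\<lambda>C. frag_of (\<one> <# C)) x = x"
    using lcosets_subset_PowG [OF assms]
    by (induction rule: frag_induction) (auto simp: frag_extend_diff lcos_mult_one)
qed

lemma (in group) G_lattice_permutation:
  assumes "subgroup H G" "finite (lcosets H)"
  shows "G_lattice G (permutation_lattice G H)"
  unfolding permutation_lattice_def
  using linear_action.G_lattice_free [OF linear_action_cosets] assms by blast

section \<open>The trivial lattice, direct sums and linear maps\<close>

lemma trivial_lattice_simps:
  "carrier trivial_lattice = UNIV" "ring.zero trivial_lattice = 0" "ring.add trivial_lattice = (+)"
  "smult trivial_lattice = (\<lambda>a m. augmentation a * m)"
  by (simp_all add: trivial_lattice_def augmentation_def fun_eq_iff)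

lemma (in group) G_lattice_trivial: "G_lattice G trivial_lattice"
proof -
  let ?Z = "trivial_lattice :: ('a \<Rightarrow>\<^sub>0 int, int) module"
  have ab: "abelian_group ?Z"
  proof (rule abelian_groupI)
    fix x :: int
    show "\<exists>y\<in>carrier ?Z. y \<oplus>\<^bsub>?Z\<^esub> x = \<zero>\<^bsub>?Z\<^esub>"
      by (rule bexI [of _ "- x"]) (simp_all add: trivial_lattice_simps)
  qed (simp_all add: trivial_lattice_simps)
  have hom: "id \<in> hom (add_monoid ?Z) integer_group"
    by (auto simp: hom_def trivial_lattice_simps)
  have "left_module (group_ring G) ?Z"
  proof (rule left_moduleI)
    fix a b :: "'a \<Rightarrow>\<^sub>0 int" and x :: int
    show "(a \<otimes>\<^bsub>group_ring G\<^esub> b) \<odot>\<^bsub>?Z\<^esub> x = a \<odot>\<^bsub>?Z\<^esub> (b \<odot>\<^bsub>?Z\<^esub> x)"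
      by (simp add: trivial_lattice_simps group_ring_def augmentation_mult)
  qed (simp_all add: ab ring_group_ring, simp_all add: trivial_lattice_simps group_ring_def
        augmentation_add algebra_simps)
  moreover have "finitely_generated_module (group_ring G) ?Z"
    unfolding finitely_generated_module_def
  proof (intro exI [of _ "{1}"] conjI allI impI)
    fix H assume H: "submodule H (group_ring G) ?Z \<and> {1} \<subseteq> H"
    have "k \<in> H" for k :: int
    proof -
      have "frag_cmul k (frag_of \<one>) \<in> carrier (group_ring G)"
        by (auto simp: group_ring_def)
      then have "frag_cmul k (frag_of \<one>) \<odot>\<^bsub>?Z\<^esub> 1 \<in> H"
        using submodule.smult_closed [of H "group_ring G" ?Z] H by simp
      then show ?thesis
        by (simp add: trivial_lattice_simps augmentation_eq_lookup frag_extend_cmul)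
    qed
    then show "H = carrier ?Z" by (auto simp: trivial_lattice_simps)
  qed (simp_all add: trivial_lattice_simps)
  moreover have "torsion_free ?Z"
    using hom_add_pow_int [OF ab _ hom]
    by (simp add: torsion_free_def trivial_lattice_simps)
  ultimately show ?thesis by (simp add: G_lattice_def)
qed

lemma module_direct_sum_simps [simp]:
  "carrier (module_direct_sum M N) = carrier M \<times> carrier N"
  "\<zero>\<^bsub>module_direct_sum M N\<^esub> = (\<zero>\<^bsub>M\<^esub>, \<zero>\<^bsub>N\<^esub>)"
  "x \<oplus>\<^bsub>module_direct_sum M N\<^esub> y = (fst x \<oplus>\<^bsub>M\<^esub> fst y, snd x \<oplus>\<^bsub>N\<^esub> snd y)"
  "a \<odot>\<^bsub>module_direct_sum M N\<^esub> x = (a \<odot>\<^bsub>M\<^esub> fst x, a \<odot>\<^bsub>N\<^esub> snd x)"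
  by (simp_all add: module_direct_sum_def)

lemma left_module_direct_sum:
  assumes "left_module R M" "left_module R N"
  shows "left_module R (module_direct_sum M N)"
proof -
  interpret M: left_module R M by fact
  interpret N: left_module R N by fact
  show ?thesis
  proof (rule left_moduleI)
    show "abelian_group (module_direct_sum M N)"
    proof (rule abelian_groupI)
      fix x assume "x \<in> carrier (module_direct_sum M N)"
      then show "\<exists>y\<in>carrier (module_direct_sum M N).
          y \<oplus>\<^bsub>module_direct_sum M N\<^esub> x = \<zero>\<^bsub>module_direct_sum M N\<^esub>"
        by (intro bexI [of _ "(\<ominus>\<^bsub>M\<^esub> fst x, \<ominus>\<^bsub>N\<^esub> snd x)"]) (auto simp: M.M.l_neg N.M.l_neg)
    qed (auto simp: M.M.a_ac N.M.a_ac)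
  qed (auto simp: M.R.ring_axioms M.smult_closed N.smult_closed M.smult_l_distr N.smult_l_distr
      M.smult_r_distr N.smult_r_distr M.smult_assoc1 N.smult_assoc1 M.smult_one N.smult_one)
qed

lemma torsion_free_direct_sum:
  assumes "abelian_group M" "abelian_group N" "abelian_group (module_direct_sum M N)"
    and "torsion_free M" "torsion_free N"
  shows "torsion_free (module_direct_sum M N)"
  unfolding torsion_free_def
proof (intro ballI allI impI)
  let ?S = "module_direct_sum M N"
  interpret M: abelian_group M by fact
  interpret N: abelian_group N by fact
  fix x and k :: int
  assume x: "x \<in> carrier ?S" and k: "k \<noteq> 0" and 0: "add_pow ?S k x = \<zero>\<^bsub>?S\<^esub>"
  have "fst \<in> hom (add_monoid ?S) (add_monoid M)"
    by (auto simp: hom_def)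
  note fst = hom_add_pow_int [OF assms(3) M.a_group this x, of k]
  have "snd \<in> hom (add_monoid ?S) (add_monoid N)"
    by (auto simp: hom_def)
  note snd = hom_add_pow_int [OF assms(3) N.a_group this x, of k]
  from fst snd 0 have "add_pow M k (fst x) = \<zero>\<^bsub>M\<^esub>" and "add_pow N k (snd x) = \<zero>\<^bsub>N\<^esub>"
    by (simp_all add: add_pow_def)
  moreover have "fst x \<in> carrier M" "snd x \<in> carrier N"
    using x by auto
  ultimately have "fst x = \<zero>\<^bsub>M\<^esub>" "snd x = \<zero>\<^bsub>N\<^esub>"
    using assms(4,5) k unfolding torsion_free_def by blast+
  then show "x = \<zero>\<^bsub>?S\<^esub>"
    by (simp add: prod_eq_iff)
qed

text \<open>A submodule of a direct sum need not be a direct sum of submodules; its preimages under the two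
  inclusions are what the generation hypotheses on the summands apply to.\<close>

lemma submodule_preimage:
  assumes "left_module R M" "left_module R N" and H: "submodule H R N"
    and f: "f \<in> hom (add_monoid M) (add_monoid N)"
    and lin: "\<And>a x. \<lbrakk>a \<in> carrier R; x \<in> carrier M\<rbrakk> \<Longrightarrow> f (a \<odot>\<^bsub>M\<^esub> x) = a \<odot>\<^bsub>N\<^esub> f x"
  shows "submodule {x \<in> carrier M. f x \<in> H} R M"
proof -
  interpret M: left_module R M by fact
  interpret N: left_module R N by fact
  interpret f: group_hom "add_monoid M" "add_monoid N" f
    using f M.M.a_group N.M.a_group by (simp add: group_hom_def group_hom_axioms_def)
  interpret H: submodule H R N by fact
  show ?thesis
  proof (intro submodule.intro submodule_axioms.intro M.M.add.subgroupI)
    show "{x \<in> carrier M. f x \<in> H} \<noteq> {}"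
      using f.hom_one H.one_closed M.M.zero_closed by auto
  next
    fix x assume "x \<in> {x \<in> carrier M. f x \<in> H}"
    then show "\<ominus>\<^bsub>M\<^esub> x \<in> {x \<in> carrier M. f x \<in> H}"
      using f.hom_inv [of x] H.m_inv_closed [of "f x"] by (simp add: a_inv_def)
  next
    fix x y assume "x \<in> {x \<in> carrier M. f x \<in> H}" "y \<in> {x \<in> carrier M. f x \<in> H}"
    then show "x \<oplus>\<^bsub>M\<^esub> y \<in> {x \<in> carrier M. f x \<in> H}"
      using f.hom_mult [of x y] H.m_closed [of "f x" "f y"] by simp
  qed (auto simp: M.smult_closed lin)
qed

lemma (in left_module) smult_r_null:
  assumes "a \<in> carrier R"
  shows "a \<odot>\<^bsub>M\<^esub> \<zero>\<^bsub>M\<^esub> = \<zero>\<^bsub>M\<^esub>"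
  using smult_r_distr [OF assms M.zero_closed M.zero_closed] smult_closed [OF assms M.zero_closed]
  by (simp add: M.add.r_cancel_one')

lemma finitely_generated_direct_sum:
  assumes M: "left_module R M" and N: "left_module R N"
    and "finitely_generated_module R M" "finitely_generated_module R N"
  shows "finitely_generated_module R (module_direct_sum M N)"
proof -
  let ?S = "module_direct_sum M N"
  interpret M: left_module R M by fact
  interpret N: left_module R N by fact
  interpret S: left_module R ?S using M N by (rule left_module_direct_sum)
  obtain A where A: "finite A" "A \<subseteq> carrier M"
    and A_gen: "\<And>H. submodule H R M \<Longrightarrow> A \<subseteq> H \<Longrightarrow> H = carrier M"
    using assms(3) unfolding finitely_generated_module_def by metis
  obtain B where B: "finite B" "B \<subseteq> carrier N"
    and B_gen: "\<And>H. submodule H R N \<Longrightarrow> B \<subseteq> H \<Longrightarrow> H = carrier N"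
    using assms(4) unfolding finitely_generated_module_def by metis
  show ?thesis
    unfolding finitely_generated_module_def
  proof (intro exI [of _ "A \<times> {\<zero>\<^bsub>N\<^esub>} \<union> {\<zero>\<^bsub>M\<^esub>} \<times> B"] conjI allI impI)
    fix H assume H: "submodule H R ?S \<and> A \<times> {\<zero>\<^bsub>N\<^esub>} \<union> {\<zero>\<^bsub>M\<^esub>} \<times> B \<subseteq> H"
    then interpret H: submodule H R ?S by simp
    have "submodule {x \<in> carrier M. (x, \<zero>\<^bsub>N\<^esub>) \<in> H} R M"
      by (rule submodule_preimage [OF M S.left_module_axioms])
        (use H in \<open>auto simp: hom_def N.smult_r_null\<close>)
    then have left: "(x, \<zero>\<^bsub>N\<^esub>) \<in> H" if "x \<in> carrier M" for x
      using A_gen H A that by blast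
    have "submodule {y \<in> carrier N. (\<zero>\<^bsub>M\<^esub>, y) \<in> H} R N"
      by (rule submodule_preimage [OF N S.left_module_axioms])
        (use H in \<open>auto simp: hom_def M.smult_r_null\<close>)
    then have right: "(\<zero>\<^bsub>M\<^esub>, y) \<in> H" if "y \<in> carrier N" for y
      using B_gen H B that by blast
    have "(x, y) \<in> H" if "x \<in> carrier M" "y \<in> carrier N" for x y
      using H.m_closed [OF left right, of x y] that by simp
    then show "H = carrier ?S"
      using H.subset by auto
  qed (use A B in auto)
qed

lemma G_lattice_direct_sum:
  assumes "G_lattice G M" "G_lattice G N"
  shows "G_lattice G (module_direct_sum M N)"
proof -
  have mods: "left_module (group_ring G) M" "left_module (group_ring G) N"
    using assms by (simp_all add: G_lattice_def)
  note sum = left_module_direct_sum [OF this]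
  have "torsion_free (module_direct_sum M N)"
    by (rule torsion_free_direct_sum) (use assms mods sum in \<open>simp_all add: G_lattice_def left_module_def\<close>)
  then show ?thesis
    using assms mods sum finitely_generated_direct_sum [OF mods] by (simp add: G_lattice_def)
qed

text \<open>The elements of \<open>G\<close> that commute with \<open>f\<close> form a subgroup, and the scalars that commute
  with \<open>f\<close> form an additive group containing it.\<close>

lemma (in group) group_ring_linear_if_generators:
  assumes M: "left_module (group_ring G) M" and N: "left_module (group_ring G) N"
    and f: "f \<in> hom (add_monoid M) (add_monoid N)"
    and S: "S \<subseteq> carrier G" "generate G S = carrier G"
    and lin: "\<And>g x. \<lbrakk>g \<in> S; x \<in> carrier M\<rbrakk> \<Longrightarrow> f (frag_of g \<odot>\<^bsub>M\<^esub> x) = frag_of g \<odot>\<^bsub>N\<^esub> f x"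
    and a: "a \<in> carrier (group_ring G)" and x: "x \<in> carrier M"
  shows "f (a \<odot>\<^bsub>M\<^esub> x) = a \<odot>\<^bsub>N\<^esub> f x"
proof -
  interpret M: left_module "group_ring G" M by fact
  interpret N: left_module "group_ring G" N by fact
  interpret f: group_hom "add_monoid M" "add_monoid N" f
    using f M.M.a_group N.M.a_group by (simp add: group_hom_def group_hom_axioms_def)
  have mem [simp]: "frag_of g \<in> carrier (group_ring G)" if "g \<in> carrier G" for g
    using that by (simp add: group_ring_def)
  have f_closed [simp]: "f x \<in> carrier N" if "x \<in> carrier M" for x
    using that f.hom_closed by simp
  have mult: "frag_of (g \<otimes> h) = frag_of g \<otimes>\<^bsub>group_ring G\<^esub> frag_of h" for g h
    by (simp add: group_ring_def)
  have unit: "frag_of \<one> = \<one>\<^bsub>group_ring G\<^esub>"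
    by (simp add: group_ring_def)
  have *: "\<forall>x\<in>carrier M. f (frag_of g \<odot>\<^bsub>M\<^esub> x) = frag_of g \<odot>\<^bsub>N\<^esub> f x" if "g \<in> generate G S" for g
    using that
  proof induction
    case one
    then show ?case by (simp add: unit M.smult_one N.smult_one)
  next
    case (incl g)
    then show ?case by (simp add: lin)
  next
    case (inv g)
    then have g: "g \<in> carrier G" using S by blast
    show ?case
    proof
      fix x assume x: "x \<in> carrier M"
      let ?y = "frag_of (inv g) \<odot>\<^bsub>M\<^esub> x"
      have y: "?y \<in> carrier M" using g x by (simp add: M.smult_closed)
      have "frag_of g \<odot>\<^bsub>M\<^esub> ?y = x"
        using g x by (simp flip: M.smult_assoc1 mult add: unit M.smult_one)
      then have "frag_of (inv g) \<odot>\<^bsub>N\<^esub> f x = frag_of (inv g) \<odot>\<^bsub>N\<^esub> (frag_of g \<odot>\<^bsub>N\<^esub> f ?y)"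
        using lin [OF inv y] by simp
      also have "\<dots> = f ?y"
        using g y by (simp flip: N.smult_assoc1 mult add: unit N.smult_one)
      finally show "f ?y = frag_of (inv g) \<odot>\<^bsub>N\<^esub> f x" ..
    qed
  next
    case (eng g h)
    then have "g \<in> carrier G" "h \<in> carrier G" using S by auto
    with eng show ?case
      by (simp add: mult M.smult_assoc1 N.smult_assoc1 M.smult_closed)
  qed
  have "a \<in> carrier (group_ring G) \<and> f (a \<odot>\<^bsub>M\<^esub> x) = a \<odot>\<^bsub>N\<^esub> f x"
    if "Poly_Mapping.keys a \<subseteq> carrier G" for a
    using that
  proof (induction rule: frag_induction)
    case zero
    have "\<zero>\<^bsub>group_ring G\<^esub> = 0" by (simp add: group_ring_def)
    moreover have "\<zero>\<^bsub>group_ring G\<^esub> \<odot>\<^bsub>M\<^esub> x = \<zero>\<^bsub>M\<^esub>"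
      using M.smult_l_distr [of "\<zero>\<^bsub>group_ring G\<^esub>" "\<zero>\<^bsub>group_ring G\<^esub>" x]
        M.smult_closed [of "\<zero>\<^bsub>group_ring G\<^esub>" x] x by (simp add: M.M.add.r_cancel_one')
    moreover have "\<zero>\<^bsub>group_ring G\<^esub> \<odot>\<^bsub>N\<^esub> f x = \<zero>\<^bsub>N\<^esub>"
      using N.smult_l_distr [of "\<zero>\<^bsub>group_ring G\<^esub>" "\<zero>\<^bsub>group_ring G\<^esub>" "f x"]
        N.smult_closed [of "\<zero>\<^bsub>group_ring G\<^esub>" "f x"] x by (simp add: N.M.add.r_cancel_one')
    ultimately show ?case using f.hom_one M.R.zero_closed by simp
  next
    case (one g)
    then show ?case using * S x by simp
  next
    case (diff a b)
    have keys: "a - b \<in> carrier (group_ring G)"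
      using diff keys_diff [of a b] by (auto simp: group_ring_def)
    have split: "(a - b) \<oplus>\<^bsub>group_ring G\<^esub> b = a"
      by (simp add: group_ring_def)
    have "f ((a - b) \<odot>\<^bsub>M\<^esub> x) \<oplus>\<^bsub>N\<^esub> f (b \<odot>\<^bsub>M\<^esub> x) = f (a \<odot>\<^bsub>M\<^esub> x)"
      using f.hom_mult [of "(a - b) \<odot>\<^bsub>M\<^esub> x" "b \<odot>\<^bsub>M\<^esub> x"] M.smult_l_distr [OF keys _ x, of b]
        keys diff x by (simp add: split M.smult_closed)
    also have "\<dots> = (a - b) \<odot>\<^bsub>N\<^esub> f x \<oplus>\<^bsub>N\<^esub> f (b \<odot>\<^bsub>M\<^esub> x)"
      using N.smult_l_distr [OF keys, of b "f x"] diff x by (simp add: split)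
    finally have "f ((a - b) \<odot>\<^bsub>M\<^esub> x) = (a - b) \<odot>\<^bsub>N\<^esub> f x"
      using keys diff x by (simp add: M.smult_closed N.smult_closed)
    then show ?case using keys by simp
  qed
  then show ?thesis using a by (simp add: group_ring_def)
qed

section \<open>The two operators on $\widetilde{M}_+$\<close>

lemma sum_int_mod_shift:
  assumes "0 < n"
  shows "(\<Sum>i\<in>{0..<int n}. F ((i + 1) mod int n)) = (\<Sum>i\<in>{0..<int n}. F i)"
  by (rule sum.reindex_bij_witness [of _ "\<lambda>i. (i - 1) mod int n" "\<lambda>i. (i + 1) mod int n"])
    (use assms in \<open>auto simp: mod_simps\<close>)

lemma sum_int_mod_negate:
  assumes "0 < n"
  shows "(\<Sum>i\<in>{0..<int n}. F ((- i) mod int n)) = (\<Sum>i\<in>{0..<int n}. F i)"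
  by (rule sum.reindex_bij_witness [of _ "\<lambda>i. (- i) mod int n" "\<lambda>i. (- i) mod int n"])
    (use assms in \<open>auto simp: mod_simps\<close>)

text \<open>The vector that is called \<open>X\<close> in the introduction.\<close>

definition x_sum :: "nat \<Rightarrow> M_plus_basis \<Rightarrow>\<^sub>0 int" where
  "x_sum n = (\<Sum>i\<in>{0..<int n}. frag_of (Basis_x i))"

lemma M_plus_basis_induct [consumes 1, case_names zero x w diff]:
  assumes "Poly_Mapping.keys m \<subseteq> M_plus_basis_set n"
    and "P 0" "\<And>i. \<lbrakk>0 \<le> i; i < int n\<rbrakk> \<Longrightarrow> P (frag_of (Basis_x i))" "P (frag_of Basis_w)"
    and "\<And>a b. \<lbrakk>P a; P b\<rbrakk> \<Longrightarrow> P (a - b)"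
  shows "P m"
  using assms(1)
  by (induction rule: frag_induction) (use assms in \<open>auto simp: M_plus_basis_set_def\<close>)

lemma M_plus_sigma_simps [simp]:
  "M_plus_sigma n 0 = 0"
  "M_plus_sigma n (frag_of (Basis_x i)) = frag_of (Basis_x ((i + 1) mod int n))"
  "M_plus_sigma n (frag_of Basis_w) = frag_of Basis_w"
  "M_plus_sigma n (x + y) = M_plus_sigma n x + M_plus_sigma n y"
  "M_plus_sigma n (x - y) = M_plus_sigma n x - M_plus_sigma n y"
  by (simp_all add: M_plus_sigma_def frag_extend_add frag_extend_diff)

lemma M_plus_tau_simps [simp]:
  "M_plus_tau n 0 = 0"
  "M_plus_tau n (frag_of (Basis_x i)) = frag_of (Basis_x ((- i) mod int n))"
  "M_plus_tau n (frag_of Basis_w) = x_sum n - frag_of Basis_w"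
  "M_plus_tau n (x + y) = M_plus_tau n x + M_plus_tau n y"
  "M_plus_tau n (x - y) = M_plus_tau n x - M_plus_tau n y"
  by (simp_all add: M_plus_tau_def frag_extend_add frag_extend_diff x_sum_def)

lemma M_plus_sigma_x_sum [simp]: "0 < n \<Longrightarrow> M_plus_sigma n (x_sum n) = x_sum n"
  using sum_int_mod_shift [of n "\<lambda>i. frag_of (Basis_x i)"]
  by (simp add: x_sum_def M_plus_sigma_def frag_extend_sum comp_def)

lemma M_plus_tau_x_sum [simp]: "0 < n \<Longrightarrow> M_plus_tau n (x_sum n) = x_sum n"
  using sum_int_mod_negate [of n "\<lambda>i. frag_of (Basis_x i)"]
  by (simp add: x_sum_def M_plus_tau_def frag_extend_sum comp_def)

lemma keys_x_sum: "Poly_Mapping.keys (x_sum n) \<subseteq> M_plus_basis_set n"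
  unfolding x_sum_def
  by (rule order_trans [OF keys_sum]) (auto simp: M_plus_basis_set_def)

lemma M_plus_sigma_closed:
  assumes "0 < n" "Poly_Mapping.keys m \<subseteq> M_plus_basis_set n"
  shows "Poly_Mapping.keys (M_plus_sigma n m) \<subseteq> M_plus_basis_set n"
  unfolding M_plus_sigma_def
  by (rule keys_frag_extend_subset) (use assms in \<open>auto simp: M_plus_basis_set_def\<close>)

lemma M_plus_tau_closed:
  assumes "0 < n" "Poly_Mapping.keys m \<subseteq> M_plus_basis_set n"
  shows "Poly_Mapping.keys (M_plus_tau n m) \<subseteq> M_plus_basis_set n"
  using assms(2)
proof (induction rule: M_plus_basis_induct)
  case w
  show ?case
    using keys_diff [of "x_sum n" "frag_of Basis_w"] keys_x_sum [of n]
    by (auto simp: M_plus_basis_set_def)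
next
  case (diff a b)
  then show ?case
    using keys_diff [of "M_plus_tau n a" "M_plus_tau n b"] by auto
qed (use assms in \<open>auto simp: M_plus_basis_set_def\<close>)

lemma M_plus_sigma_funpow_0 [simp]: "(M_plus_sigma n ^^ k) 0 = 0"
  and M_plus_sigma_funpow_diff:
    "(M_plus_sigma n ^^ k) (x - y) = (M_plus_sigma n ^^ k) x - (M_plus_sigma n ^^ k) y"
  and M_plus_sigma_funpow_w [simp]: "(M_plus_sigma n ^^ k) (frag_of Basis_w) = frag_of Basis_w"
  and M_plus_sigma_funpow_x: "\<lbrakk>0 \<le> i; i < int n\<rbrakk> \<Longrightarrow>
    (M_plus_sigma n ^^ k) (frag_of (Basis_x i)) = frag_of (Basis_x ((i + int k) mod int n))"
  by (induction k) (simp_all add: mod_simps add_ac)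

lemma M_plus_sigma_order:
  assumes "Poly_Mapping.keys m \<subseteq> M_plus_basis_set n"
  shows "(M_plus_sigma n ^^ n) m = m"
  using assms
  by (induction rule: M_plus_basis_induct)
    (simp_all add: M_plus_sigma_funpow_diff M_plus_sigma_funpow_x)

lemma M_plus_tau_involution:
  assumes "0 < n" "Poly_Mapping.keys m \<subseteq> M_plus_basis_set n"
  shows "M_plus_tau n (M_plus_tau n m) = m"
  using assms(2)
  by (induction rule: M_plus_basis_induct) (simp_all add: assms mod_simps)

text \<open>Given that \<open>\<tau>\<close> is an involution, this is the relation \<open>\<tau>\<sigma>\<tau>\<inverse> = \<sigma>\<inverse>\<close> in a form
  that mentions no inverse operators.\<close>

lemma M_plus_tau_sigma_involution:
  assumes "0 < n" "Poly_Mapping.keys m \<subseteq> M_plus_basis_set n"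
  shows "M_plus_tau n (M_plus_sigma n (M_plus_tau n (M_plus_sigma n m))) = m"
  using assms(2)
proof (induction rule: M_plus_basis_induct)
  case (x i)
  have "(- ((- i - 1) mod int n) - 1) mod int n = (- (- i - 1) - 1) mod int n"
    by (intro mod_diff_cong mod_minus_cong) simp_all
  with x show ?case by (simp add: mod_simps)
qed (simp_all add: assms)

section \<open>The dihedral group and its action on $\widetilde{M}_+$\<close>

lemma range_case_dihedral_gen: "range (case_dihedral_gen s t) = {s, t}"
  by (auto simp: image_iff split: dihedral_gen.splits)

locale dihedral_group = group G for G (structure) +
  fixes n :: nat and \<sigma> \<tau>
  assumes n_pos: "0 < n" and presentation: "dihedral_presentation n G \<sigma> \<tau>"
begin

lemma generators: "{\<sigma>, \<tau>} \<subseteq> carrier G" "generate G {\<sigma>, \<tau>} = carrier G"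
  using presentation
  by (auto simp: dihedral_presentation_def has_presentation_def range_case_dihedral_gen)

lemma sigma_closed [simp]: "\<sigma> \<in> carrier G" and tau_closed [simp]: "\<tau> \<in> carrier G"
  using generators by auto

lemma word_eval_one:
  assumes "presentation_eq (dihedral_relations n) w []"
  shows "word_eval G (case_dihedral_gen \<sigma> \<tau>) w = \<one>"
  using presentation assms by (simp add: dihedral_presentation_def has_presentation_def)

lemma relation_holds:
  assumes "(l, []) \<in> dihedral_relations n"
  shows "word_eval G (case_dihedral_gen \<sigma> \<tau>) l = \<one>"
  using word_eval_one presentation_eq.relation [OF assms, of "[]" "[]"] by simp

lemma sigma_pow_n: "\<sigma> [^] n = \<one>"
  using relation_holds [of "replicate n (Sigma_gen, True)"]
  by (simp add: dihedral_relations_def word_eval_replicate)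

lemma tau_tau: "\<tau> \<otimes> \<tau> = \<one>"
  using relation_holds [of "replicate 2 (Tau_gen, True)"]
  by (simp add: dihedral_relations_def numeral_2_eq_2)

lemma inv_tau: "inv \<tau> = \<tau>"
  using tau_tau by (simp add: inv_equality)

text \<open>A presentation says which words are trivial, whereas the third relation equates two nontrivial
  words; appending \<open>\<sigma>\<close> to both of its sides turns it into a statement about a trivial word.\<close>

lemma tau_sigma: "\<tau> \<otimes> \<sigma> = inv \<sigma> \<otimes> \<tau>"
proof -
  let ?R = "dihedral_relations n"
  let ?v = "[(Sigma_gen, True)] :: dihedral_gen word"
  have "presentation_eq ?R ([] @ [(Tau_gen, True), (Sigma_gen, True), (Tau_gen, False)] @ ?v)
      ([] @ [(Sigma_gen, False)] @ ?v)"
    by (rule presentation_eq.relation) (simp add: dihedral_relations_def)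
  moreover have "presentation_eq ?R ([] @ [(Sigma_gen, False), (Sigma_gen, \<not> False)] @ []) ([] @ [])"
    by (rule presentation_eq.cancel)
  ultimately have "presentation_eq ?R
      [(Tau_gen, True), (Sigma_gen, True), (Tau_gen, False), (Sigma_gen, True)] []"
    by (simp add: presentation_eq.trans)
  from word_eval_one [OF this] have "\<tau> \<otimes> \<sigma> \<otimes> inv \<tau> \<otimes> \<sigma> = \<one>"
    by (simp add: m_assoc)
  then have "inv \<sigma> = \<tau> \<otimes> \<sigma> \<otimes> inv \<tau>"
    by (simp add: inv_equality)
  then show ?thesis
    by (simp add: m_assoc)
qed

lemma tau_sigma_pow: "\<tau> \<otimes> \<sigma> [^] (k::int) = \<sigma> [^] (- k) \<otimes> \<tau>"
proof -
  have conj: "\<tau> \<otimes> \<sigma> [^] i \<otimes> \<tau> = inv (\<sigma> [^] i)" for i :: nat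
  proof (induction i)
    case (Suc i)
    have "\<tau> \<otimes> \<sigma> [^] Suc i \<otimes> \<tau> = \<tau> \<otimes> \<sigma> [^] i \<otimes> (\<tau> \<otimes> \<tau>) \<otimes> \<sigma> \<otimes> \<tau>"
      by (simp add: m_assoc tau_tau)
    also have "\<dots> = (\<tau> \<otimes> \<sigma> [^] i \<otimes> \<tau>) \<otimes> (\<tau> \<otimes> \<sigma>) \<otimes> \<tau>"
      by (simp add: m_assoc)
    also have "\<dots> = inv (\<sigma> [^] i) \<otimes> inv \<sigma>"
      by (simp add: Suc tau_sigma m_assoc tau_tau)
    also have "\<dots> = inv (\<sigma> \<otimes> \<sigma> [^] i)"
      by (simp add: inv_mult_group)
    also have "\<dots> = inv (\<sigma> [^] Suc i)"
      by (simp only: nat_pow_Suc2 sigma_closed)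
    finally show ?case .
  qed (simp add: tau_tau)
  have "\<tau> \<otimes> \<sigma> [^] k \<otimes> \<tau> = inv (\<sigma> [^] k)"
  proof (cases k rule: int_cases2)
    case (nonneg i)
    then show ?thesis using conj by (simp add: int_pow_int)
  next
    case (nonpos i)
    have "inv (\<tau> \<otimes> \<sigma> [^] i \<otimes> \<tau>) = \<tau> \<otimes> inv (\<sigma> [^] i) \<otimes> \<tau>"
      by (simp add: inv_mult_group inv_tau m_assoc)
    then show ?thesis
      using nonpos by (simp add: conj int_pow_neg_int)
  qed
  then have "\<tau> \<otimes> \<sigma> [^] k \<otimes> \<tau> \<otimes> \<tau> = inv (\<sigma> [^] k) \<otimes> \<tau>"
    by simp
  then show ?thesis
    by (simp add: m_assoc tau_tau int_pow_neg)
qed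

lemma elements:
  assumes "g \<in> carrier G"
  obtains i :: int where "g = \<sigma> [^] i" | i :: int where "g = \<sigma> [^] i \<otimes> \<tau>"
proof -
  have "\<exists>i::int. g = \<sigma> [^] i \<or> g = \<sigma> [^] i \<otimes> \<tau>" if "g \<in> generate G {\<sigma>, \<tau>}" for g
    using that
  proof induction
    case one
    show ?case by (rule exI [of _ 0]) simp
  next
    case (incl g)
    then show ?case
      by (metis insertE singletonD int_pow_0 int_pow_1 l_one sigma_closed tau_closed)
  next
    case (inv g)
    then show ?case
      by (metis insertE singletonD int_pow_0 int_pow_1 int_pow_neg inv_tau l_one sigma_closed tau_closed)
  next
    case (eng g h)
    then obtain i j :: int where
      g: "g = \<sigma> [^] i \<or> g = \<sigma> [^] i \<otimes> \<tau>" and h: "h = \<sigma> [^] j \<or> h = \<sigma> [^] j \<otimes> \<tau>"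
      by blast
    have "\<sigma> [^] i \<otimes> \<tau> \<otimes> \<sigma> [^] j = (\<sigma> [^] i \<otimes> \<sigma> [^] (- j)) \<otimes> \<tau>"
      by (simp only: m_assoc tau_sigma_pow int_pow_closed sigma_closed tau_closed)
    also have "\<sigma> [^] i \<otimes> \<sigma> [^] (- j) = \<sigma> [^] (i - j)"
      by (simp only: diff_conv_add_uminus int_pow_mult sigma_closed)
    finally have *: "\<sigma> [^] i \<otimes> \<tau> \<otimes> \<sigma> [^] j = \<sigma> [^] (i - j) \<otimes> \<tau>" .
    have **: "\<sigma> [^] i \<otimes> \<tau> \<otimes> (\<sigma> [^] j \<otimes> \<tau>) = \<sigma> [^] (i - j)"
      using arg_cong [OF *, of "\<lambda>x. x \<otimes> \<tau>"] by (simp add: m_assoc tau_tau)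
    have "g \<otimes> h \<in> {\<sigma> [^] (i + j), \<sigma> [^] (i + j) \<otimes> \<tau>, \<sigma> [^] (i - j) \<otimes> \<tau>, \<sigma> [^] (i - j)}"
      using g h * ** by (auto simp: int_pow_mult m_assoc)
    then show ?case by blast
  qed
  then show ?thesis
    using assms that generators(2) by metis
qed

abbreviation M_plus_carrier :: "(M_plus_basis \<Rightarrow>\<^sub>0 int) set" where
  "M_plus_carrier \<equiv> carrier (free_Abelian_group (M_plus_basis_set n))"

lemma restricted_generators_in_BijGroup:
  "restrict (M_plus_sigma n) M_plus_carrier \<in> carrier (BijGroup M_plus_carrier)"
  "restrict (M_plus_tau n) M_plus_carrier \<in> carrier (BijGroup M_plus_carrier)"
proof -
  have closed: "(M_plus_sigma n ^^ k) x \<in> M_plus_carrier" if "x \<in> M_plus_carrier" for x k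
    using that by (induction k) (simp_all add: M_plus_sigma_closed n_pos)
  have "(M_plus_sigma n ^^ (n - 1)) (M_plus_sigma n x) = (M_plus_sigma n ^^ n) x"
    "M_plus_sigma n ((M_plus_sigma n ^^ (n - 1)) x) = (M_plus_sigma n ^^ n) x" for x
    using n_pos by (cases n; simp add: funpow_swap1)+
  then show "restrict (M_plus_sigma n) M_plus_carrier \<in> carrier (BijGroup M_plus_carrier)"
    by (intro restrict_in_BijGroup [of _ _ "M_plus_sigma n ^^ (n - 1)"] closed [of _ 1, simplified] closed)
      (simp_all add: M_plus_sigma_order M_plus_sigma_closed n_pos)
  show "restrict (M_plus_tau n) M_plus_carrier \<in> carrier (BijGroup M_plus_carrier)"
    by (rule restrict_in_BijGroup [of _ _ "M_plus_tau n"])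
      (simp_all add: M_plus_tau_closed M_plus_tau_involution n_pos)
qed

text \<open>Von Dyck's theorem for the group of bijections of \<open>M\<^sub>+\<close>: what has to be checked are the
  three relations for the operators of \<open>\<sigma>\<close> and \<open>\<tau>\<close>.\<close>

lemma M_plus_action_exists:
  obtains \<rho> where "group_action G M_plus_carrier \<rho>"
    "\<rho> \<sigma> = restrict (M_plus_sigma n) M_plus_carrier"
    "\<rho> \<tau> = restrict (M_plus_tau n) M_plus_carrier"
proof -
  let ?E = M_plus_carrier and ?H = "BijGroup M_plus_carrier"
  interpret H: group ?H by (rule group_BijGroup)
  define p q where "p = restrict (M_plus_sigma n) ?E" and "q = restrict (M_plus_tau n) ?E"
  have mem: "p \<in> carrier ?H" "q \<in> carrier ?H"
    unfolding p_def q_def by (rule restricted_generators_in_BijGroup)+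
  have one: "\<one>\<^bsub>?H\<^esub> = restrict id ?E"
    by (simp add: BijGroup_def id_def)
  have p_pow: "p [^]\<^bsub>?H\<^esub> n = \<one>\<^bsub>?H\<^esub>"
    using mem unfolding p_def one
    by (simp add: BijGroup_pow_restrict M_plus_sigma_order cong: restrict_cong)
  have q_q: "q \<otimes>\<^bsub>?H\<^esub> q = \<one>\<^bsub>?H\<^esub>"
    using mem unfolding q_def one
    by (simp add: BijGroup_mult_restrict M_plus_tau_involution n_pos cong: restrict_cong)
  have qp: "q \<otimes>\<^bsub>?H\<^esub> p = restrict (M_plus_tau n \<circ> M_plus_sigma n) ?E"
    using mem unfolding p_def q_def by (rule BijGroup_mult_restrict [rotated])
  have "(q \<otimes>\<^bsub>?H\<^esub> p) \<otimes>\<^bsub>?H\<^esub> (q \<otimes>\<^bsub>?H\<^esub> p) = \<one>\<^bsub>?H\<^esub>"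
    using H.m_closed [OF mem(2,1)] unfolding qp one
    by (simp add: BijGroup_mult_restrict M_plus_tau_sigma_involution n_pos cong: restrict_cong)
  then have inv_p: "inv\<^bsub>?H\<^esub> p = q \<otimes>\<^bsub>?H\<^esub> (p \<otimes>\<^bsub>?H\<^esub> q)"
    using mem by (intro H.inv_equality) (simp_all add: H.m_assoc)
  have inv_q: "inv\<^bsub>?H\<^esub> q = q"
    using mem q_q by (intro H.inv_equality)
  have "range (case_dihedral_gen p q) \<subseteq> carrier ?H"
    using mem by (simp add: range_case_dihedral_gen)
  moreover have "word_eval ?H (case_dihedral_gen p q) l = word_eval ?H (case_dihedral_gen p q) r"
    if "(l, r) \<in> dihedral_relations n" for l r
    using that mem p_pow q_q
    by (auto simp: dihedral_relations_def H.word_eval_replicate inv_p inv_q numeral_2_eq_2)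
  ultimately obtain \<rho> where \<rho>: "\<rho> \<in> hom G ?H" "\<And>x. \<rho> (case_dihedral_gen \<sigma> \<tau> x) = case_dihedral_gen p q x"
    using von_Dyck [OF presentation [unfolded dihedral_presentation_def] group_BijGroup] by metis
  show ?thesis
  proof
    show "group_action G M_plus_carrier \<rho>"
      using \<rho>(1) by (simp add: group_action_def group_hom_def group_hom_axioms_def)
    show "\<rho> \<sigma> = restrict (M_plus_sigma n) ?E" "\<rho> \<tau> = restrict (M_plus_tau n) ?E"
      using \<rho>(2) [of Sigma_gen] \<rho>(2) [of Tau_gen] by (simp_all add: p_def q_def)
  qed
qed

definition M_plus_action :: "'a \<Rightarrow> (M_plus_basis \<Rightarrow>\<^sub>0 int) \<Rightarrow> (M_plus_basis \<Rightarrow>\<^sub>0 int)" where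
  "M_plus_action =
    action_from_generators G \<sigma> \<tau> M_plus_carrier (M_plus_sigma n) (M_plus_tau n)"

lemma group_action_M_plus: "group_action G M_plus_carrier M_plus_action"
  and M_plus_action_sigma: "m \<in> M_plus_carrier \<Longrightarrow> M_plus_action \<sigma> m = M_plus_sigma n m"
  and M_plus_action_tau: "m \<in> M_plus_carrier \<Longrightarrow> M_plus_action \<tau> m = M_plus_tau n m"
proof -
  obtain \<rho> where "group_action G M_plus_carrier \<rho>"
    "\<rho> \<sigma> = restrict (M_plus_sigma n) M_plus_carrier"
    "\<rho> \<tau> = restrict (M_plus_tau n) M_plus_carrier"
    by (rule M_plus_action_exists)
  note * = action_from_generators_properties [OF this(1) generators(2) this(2,3), folded M_plus_action_def]
  show "group_action G M_plus_carrier M_plus_action"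
    by (rule *)
  show "m \<in> M_plus_carrier \<Longrightarrow> M_plus_action \<sigma> m = M_plus_sigma n m"
    "m \<in> M_plus_carrier \<Longrightarrow> M_plus_action \<tau> m = M_plus_tau n m"
    by (simp_all only: * restrict_apply' )
qed

lemma linear_action_M_plus: "linear_action G (M_plus_basis_set n) M_plus_action"
proof (rule linear_action_if_generators [OF _ generators])
  have "M_plus_carrier = {x. Poly_Mapping.keys x \<subseteq> M_plus_basis_set n}"
    by auto
  then show "group_action G {x. Poly_Mapping.keys x \<subseteq> M_plus_basis_set n} M_plus_action"
    using group_action_M_plus by simp
next
  fix g and x y :: "M_plus_basis \<Rightarrow>\<^sub>0 int"
  assume "g \<in> {\<sigma>, \<tau>}" and xy: "Poly_Mapping.keys x \<subseteq> M_plus_basis_set n"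
    "Poly_Mapping.keys y \<subseteq> M_plus_basis_set n"
  moreover have "Poly_Mapping.keys (x + y) \<subseteq> M_plus_basis_set n"
    using xy keys_add [of x y] by blast
  ultimately show "M_plus_action g (x + y) = M_plus_action g x + M_plus_action g y"
    by (auto simp: M_plus_action_sigma M_plus_action_tau)
qed

lemma M_plus_action_sigma_pow:
  assumes "m \<in> M_plus_carrier"
  shows "M_plus_action (\<sigma> [^] (k::nat)) m = (M_plus_sigma n ^^ k) m"
proof -
  interpret group_action G M_plus_carrier M_plus_action by (rule group_action_M_plus)
  have closed: "(M_plus_sigma n ^^ k) m \<in> M_plus_carrier" for k
    using assms by (induction k) (simp_all add: M_plus_sigma_closed n_pos)
  show ?thesis
  proof (induction k)
    case 0
    then show ?case
      using fun_cong [OF id_eq_one, of m] assms by simp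
  next
    case (Suc k)
    have "M_plus_action (\<sigma> [^] Suc k) m = M_plus_action (\<sigma> \<otimes> \<sigma> [^] k) m"
      by (simp only: nat_pow_Suc2 sigma_closed)
    also have "\<dots> = (M_plus_sigma n ^^ Suc k) m"
      using composition_rule [OF assms, of \<sigma> "\<sigma> [^] k"] closed [of k] Suc
      by (simp add: M_plus_action_sigma)
    finally show ?case .
  qed
qed

lemma sigma_pow_mod: "\<sigma> [^] (k mod int n) = \<sigma> [^] k"
proof -
  have "\<sigma> [^] (int n * (k div int n)) = \<one>"
    by (simp flip: int_pow_pow add: int_pow_int sigma_pow_n)
  moreover have "\<sigma> [^] k = \<sigma> [^] (int n * (k div int n) + k mod int n)"
    by simp
  ultimately show ?thesis
    by (simp only: int_pow_mult sigma_closed l_one int_pow_closed)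
qed

lemma sigma_pow_eq_natE:
  obtains j :: nat where "j < n" "k mod int n = int j" "\<sigma> [^] (k::int) = \<sigma> [^] j"
proof
  show "nat (k mod int n) < n" "k mod int n = int (nat (k mod int n))"
    using n_pos by (simp_all add: nat_less_iff)
  then show "\<sigma> [^] k = \<sigma> [^] nat (k mod int n)"
    by (metis int_pow_int sigma_pow_mod)
qed

text \<open>The lattice serves as a model in which the order of \<open>\<sigma>\<close> can be measured: \<open>\<sigma>\<^sup>j\<close> maps \<open>x\<^sub>0\<close> to
  \<open>x\<^sub>j\<close> for \<open>j < n\<close>.\<close>

lemma sigma_pow_eq_one_iff: "\<sigma> [^] (k::int) = \<one> \<longleftrightarrow> k mod int n = 0"
proof
  assume 1: "\<sigma> [^] k = \<one>"
  obtain j where j: "j < n" "k mod int n = int j" "\<sigma> [^] k = \<sigma> [^] j"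
    by (rule sigma_pow_eq_natE)
  have mem: "frag_of (Basis_x 0) \<in> M_plus_carrier"
    using n_pos by (auto simp: M_plus_basis_set_def)
  have "(M_plus_sigma n ^^ j) (frag_of (Basis_x 0)) = (M_plus_sigma n ^^ 0) (frag_of (Basis_x 0))"
    using M_plus_action_sigma_pow [OF mem, of j] M_plus_action_sigma_pow [OF mem, of 0] j 1 by simp
  then show "k mod int n = 0"
    using j n_pos by (simp add: M_plus_sigma_funpow_x frag_of_eq)
next
  assume "k mod int n = 0"
  then show "\<sigma> [^] k = \<one>"
    using sigma_pow_mod [of k] by simp
qed

text \<open>In the lattice every power of \<open>\<sigma>\<close> fixes \<open>w\<close>, while \<open>\<tau>\<close> changes the sign of its coefficient
  at \<open>w\<close>.\<close>

lemma tau_neq_sigma_pow: "\<tau> \<noteq> \<sigma> [^] (k::int)"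
proof
  assume "\<tau> = \<sigma> [^] k"
  then obtain j :: nat where j: "\<tau> = \<sigma> [^] j"
    by (metis sigma_pow_eq_natE)
  have mem: "frag_of Basis_w \<in> M_plus_carrier"
    by (simp add: M_plus_basis_set_def)
  have "x_sum n - frag_of Basis_w = frag_of Basis_w"
    using M_plus_action_tau [OF mem] M_plus_action_sigma_pow [OF mem, of j] j by simp
  then have "Poly_Mapping.lookup (x_sum n - frag_of Basis_w) Basis_w = 1"
    by simp
  then show False
    by (simp add: x_sum_def lookup_minus lookup_sum)
qed

lemma G_lattice_M_plus: "G_lattice G (M_plus n G \<sigma> \<tau>)"
  unfolding M_plus_def M_plus_action_def [symmetric]
  by (rule linear_action.G_lattice_free [OF linear_action_M_plus]) (simp add: M_plus_basis_set_def)

section \<open>Cosets in the dihedral group\<close>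

abbreviation rotations :: "'a set" where "rotations \<equiv> generate G {\<sigma>}"

abbreviation reflections :: "'a set" where "reflections \<equiv> \<tau> <# rotations"

abbreviation tau_group :: "'a set" where "tau_group \<equiv> generate G {\<tau>}"

text \<open>The index ranges over all integers, so that \<open>\<sigma>\<close> and \<open>\<tau>\<close> act on it by plain addition and negation;
  reduction modulo \<open>n\<close> is needed only when the cosets are enumerated.\<close>

definition y_coset :: "int \<Rightarrow> 'a set" where "y_coset i = \<sigma> [^] i <# tau_group"

lemma subgroup_rotations: "subgroup rotations G" and subgroup_tau_group: "subgroup tau_group G"
  by (simp_all add: generate_is_subgroup)

lemma rotations_eq: "rotations = {\<sigma> [^] (k::int) | k. True}"
  by (simp add: generate_pow)

lemma tau_group_eq: "tau_group = {\<one>, \<tau>}"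
proof
  show "tau_group \<subseteq> {\<one>, \<tau>}"
    by (rule generate_subgroup_incl [of "{\<tau>}" "{\<one>, \<tau>}"])
      (auto simp: tau_tau inv_tau intro!: subgroupI)
  show "{\<one>, \<tau>} \<subseteq> tau_group"
    by (auto intro: generate.one generate.incl)
qed

lemma coset_eqI:
  assumes "subgroup H G" "g \<in> carrier G" "h \<in> H"
  shows "g \<otimes> h <# H = g <# H"
  using assms lcos_m_assoc [of H g h] subgroup.subset [OF assms(1)] coset_join3 [of h H]
  by auto

lemma tau_notin_rotations: "\<tau> \<notin> rotations"
  using tau_neq_sigma_pow by (auto simp: rotations_eq)

lemma reflections_neq_rotations: "reflections \<noteq> rotations"
proof
  assume "reflections = rotations"
  moreover have "\<tau> \<in> reflections"
    using lcos_self [OF tau_closed subgroup_rotations] .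
  ultimately show False
    using tau_notin_rotations by simp
qed

lemma coset_mult:
  assumes "subgroup H G" "g \<in> carrier G" "h \<in> carrier G"
  shows "g <# (h <# H) = g \<otimes> h <# H"
  using assms by (simp add: lcos_m_assoc subgroup.subset)

lemma sigma_pow_rotations: "\<sigma> [^] (k::int) <# rotations = rotations"
  by (rule coset_join3 [OF _ subgroup_rotations]) (auto simp: rotations_eq)

lemma sigma_reflections: "\<sigma> <# reflections = reflections"
proof -
  have "\<sigma> \<otimes> \<tau> = \<tau> \<otimes> \<sigma> [^] (-1::int)"
    using tau_sigma_pow [of "-1"] by simp
  then have "\<sigma> <# reflections = \<tau> <# (\<sigma> [^] (-1::int) <# rotations)"
    by (simp add: coset_mult subgroup_rotations)
  then show ?thesis by (simp only: sigma_pow_rotations)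
qed

lemma tau_reflections: "\<tau> <# reflections = rotations"
  by (simp add: coset_mult subgroup_rotations tau_tau lcos_mult_one subgroup.subset)

lemma lcosets_rotations: "lcosets rotations = {rotations, reflections}"
proof
  show "lcosets rotations \<subseteq> {rotations, reflections}"
  proof
    fix C assume "C \<in> lcosets rotations"
    then obtain g where g: "g \<in> carrier G" "C = g <# rotations"
      by (auto simp: LCOSETS_def)
    from g(1) show "C \<in> {rotations, reflections}"
    proof (cases rule: elements)
      case (1 i)
      then show ?thesis using g sigma_pow_rotations by simp
    next
      case (2 i)
      then have "C = \<tau> \<otimes> \<sigma> [^] (- i) <# rotations"
        using g tau_sigma_pow [of "- i"] by simp
      also have "\<dots> = reflections"
        by (rule coset_eqI [OF subgroup_rotations]) (auto simp: rotations_eq)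
      finally show ?thesis by simp
    qed
  qed
  have "rotations = \<one> <# rotations"
    by (simp add: lcos_mult_one subgroup.subset subgroup_rotations)
  then show "{rotations, reflections} \<subseteq> lcosets rotations"
    by (force simp: LCOSETS_def)
qed

lemma sigma_y_coset: "\<sigma> <# y_coset i = y_coset (i + 1)"
  using int_pow_mult [of \<sigma> 1 i]
  by (simp add: y_coset_def coset_mult subgroup_tau_group add.commute)

lemma tau_y_coset: "\<tau> <# y_coset i = y_coset (- i)"
  unfolding y_coset_def
  by (simp add: coset_mult subgroup_tau_group tau_sigma_pow)
    (rule coset_eqI [OF subgroup_tau_group], auto simp: tau_group_eq)

lemma y_coset_mod: "y_coset (i mod int n) = y_coset i"
  by (simp add: y_coset_def sigma_pow_mod)

lemma lcosets_tau_group: "lcosets tau_group = y_coset ` {0..<int n}"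
proof
  show "lcosets tau_group \<subseteq> y_coset ` {0..<int n}"
  proof
    fix C assume "C \<in> lcosets tau_group"
    then obtain g where g: "g \<in> carrier G" "C = g <# tau_group"
      by (auto simp: LCOSETS_def)
    have "\<exists>i. C = y_coset i"
      using g(1)
    proof (cases rule: elements)
      case (1 i)
      then show ?thesis using g by (auto simp: y_coset_def)
    next
      case (2 i)
      then have "C = y_coset i"
        using g coset_eqI [OF subgroup_tau_group, of "\<sigma> [^] i" \<tau>]
        by (simp add: y_coset_def tau_group_eq)
      then show ?thesis ..
    qed
    then obtain i where "C = y_coset (i mod int n)"
      using y_coset_mod by metis
    then show "C \<in> y_coset ` {0..<int n}"
      using n_pos by simp
  qed
  show "y_coset ` {0..<int n} \<subseteq> lcosets tau_group"
    using int_pow_closed [OF sigma_closed] by (fastforce simp: y_coset_def LCOSETS_def)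
qed

lemma y_coset_inj: "inj_on y_coset {0..<int n}"
proof (rule inj_onI)
  \<comment> \<open>Equal cosets would make \<open>\<sigma>\<^sup>i\<^sup>-\<^sup>j\<close> equal to \<open>1\<close> or to \<open>\<tau>\<close>, and the latter is not a power of \<open>\<sigma>\<close>.\<close>
  fix i j assume ij: "i \<in> {0..<int n}" "j \<in> {0..<int n}" and "y_coset i = y_coset j"
  then have "\<sigma> [^] i \<in> \<sigma> [^] j <# tau_group"
    using lcos_self [OF _ subgroup_tau_group, of "\<sigma> [^] i"] by (simp add: y_coset_def)
  then obtain t where t: "t \<in> {\<one>, \<tau>}" "\<sigma> [^] i = \<sigma> [^] j \<otimes> t"
    unfolding l_coset_def tau_group_eq by blast
  then have "t = inv (\<sigma> [^] j) \<otimes> \<sigma> [^] i"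
    by (auto simp: inv_solve_left)
  also have "\<dots> = \<sigma> [^] (- j + i)"
    by (simp only: int_pow_mult int_pow_neg sigma_closed)
  finally have "t = \<sigma> [^] (i - j)"
    by simp
  then have "\<sigma> [^] (i - j) = \<one>"
    using t tau_neq_sigma_pow by auto
  then have "(i - j) mod int n = 0"
    by (simp add: sigma_pow_eq_one_iff)
  then have "i mod int n = j mod int n"
    by (simp add: mod_eq_dvd_iff mod_0_imp_dvd)
  then show "i = j" using ij by simp
qed

end

section \<open>The isomorphism\<close>

locale odd_dihedral_group = dihedral_group +
  assumes odd_n: "odd n"
begin

text \<open>The number \<open>c\<close> of the introduction.\<close>

definition half :: int where "half = (int n + 1) div 2"

lemma n_eq: "int n = 2 * half - 1"
  using odd_n by (auto simp: half_def elim: oddE)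

text \<open>The vectors \<open>A\<close> and \<open>Y\<close> of the introduction. Both are fixed by all of \<open>G\<close>.\<close>

definition coset_sum :: "'a set \<Rightarrow>\<^sub>0 int" where
  "coset_sum = frag_of rotations + frag_of reflections"

definition y_sum :: "'a set \<Rightarrow>\<^sub>0 int" where
  "y_sum = (\<Sum>i\<in>{0..<int n}. frag_of (y_coset i))"

abbreviation translate :: "'a \<Rightarrow> ('a set \<Rightarrow>\<^sub>0 int) \<Rightarrow> ('a set \<Rightarrow>\<^sub>0 int)" where
  "translate g \<equiv> frag_extend (\<lambda>C. frag_of (g <# C))"

text \<open>The two components of the restriction of the isomorphism to \<open>M\<^sub>+\<close>, as given by
  \<open>x\<^sub>i \<mapsto> y\<^sub>i - A + Y\<close> and \<open>w \<mapsto> a\<^sub>0 - c A + c Y\<close>.\<close>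

definition to_rotations :: "(M_plus_basis \<Rightarrow>\<^sub>0 int) \<Rightarrow> ('a set \<Rightarrow>\<^sub>0 int)" where
  "to_rotations = frag_extend
    (case_M_plus_basis (\<lambda>_. - coset_sum) (frag_of rotations - frag_cmul half coset_sum))"

definition to_tau :: "(M_plus_basis \<Rightarrow>\<^sub>0 int) \<Rightarrow> ('a set \<Rightarrow>\<^sub>0 int)" where
  "to_tau = frag_extend
    (case_M_plus_basis (\<lambda>i. frag_of (y_coset i) + y_sum) (frag_cmul half y_sum))"

text \<open>The \<open>M\<^sub>+\<close>-parts \<open>w\<close>, \<open>X - w\<close> and \<open>x\<^sub>i\<close> of the images of \<open>a\<^sub>0\<close>, \<open>a\<^sub>1\<close> and \<open>y\<^sub>i\<close> under the inverse map. The
  coefficients of \<open>e\<close> in these images are \<open>c\<close>, \<open>c\<close> and \<open>1\<close>, so that the part in \<open>\<int>\<close> is expressed by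
  augmentations.\<close>

definition from_rotations :: "('a set \<Rightarrow>\<^sub>0 int) \<Rightarrow> (M_plus_basis \<Rightarrow>\<^sub>0 int)" where
  "from_rotations = frag_extend
    (\<lambda>C. if C = rotations then frag_of Basis_w else x_sum n - frag_of Basis_w)"

definition from_tau :: "('a set \<Rightarrow>\<^sub>0 int) \<Rightarrow> (M_plus_basis \<Rightarrow>\<^sub>0 int)" where
  "from_tau = frag_extend (\<lambda>C. frag_of (Basis_x (the_inv_into {0..<int n} y_coset C)))"

lemmas map_defs = to_rotations_def to_tau_def from_rotations_def from_tau_def

lemma map_additive [simp]:
  "to_rotations 0 = 0" "to_tau 0 = 0" "from_rotations 0 = 0" "from_tau 0 = 0"
  "to_rotations (a + b) = to_rotations a + to_rotations b"
  "to_tau (a + b) = to_tau a + to_tau b"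
  "from_rotations (u + v) = from_rotations u + from_rotations v"
  "from_tau (u + v) = from_tau u + from_tau v"
  "to_rotations (a - b) = to_rotations a - to_rotations b"
  "to_tau (a - b) = to_tau a - to_tau b"
  "from_rotations (u - v) = from_rotations u - from_rotations v"
  "from_tau (u - v) = from_tau u - from_tau v"
  "from_rotations (- u) = - from_rotations u"
  "from_rotations (frag_cmul k u) = frag_cmul k (from_rotations u)"
  "from_tau (frag_cmul k u) = frag_cmul k (from_tau u)"
  by (simp_all add: map_defs frag_extend_add frag_extend_diff frag_extend_minus frag_extend_cmul)

lemma map_basis [simp]:
  "to_rotations (frag_of (Basis_x i)) = - coset_sum"
  "to_rotations (frag_of Basis_w) = frag_of rotations - frag_cmul half coset_sum"
  "to_tau (frag_of (Basis_x i)) = frag_of (y_coset i) + y_sum"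
  "to_tau (frag_of Basis_w) = frag_cmul half y_sum"
  "from_rotations (frag_of rotations) = frag_of Basis_w"
  "from_rotations (frag_of reflections) = x_sum n - frag_of Basis_w"
  by (simp_all add: map_defs reflections_neq_rotations)

lemma from_tau_y [simp]: "\<lbrakk>0 \<le> i; i < int n\<rbrakk> \<Longrightarrow> from_tau (frag_of (y_coset i)) = frag_of (Basis_x i)"
  by (simp add: from_tau_def the_inv_into_f_f [OF y_coset_inj])

lemma map_sums [simp]:
  "to_rotations (x_sum n) = frag_cmul (- int n) coset_sum"
  "to_tau (x_sum n) = frag_cmul (int n + 1) y_sum"
  "from_rotations coset_sum = x_sum n"
  "from_tau y_sum = x_sum n"
proof -
  show "to_rotations (x_sum n) = frag_cmul (- int n) coset_sum"
    by (simp add: x_sum_def to_rotations_def frag_extend_sum comp_def sum_int_interval_const_frag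
        flip: minus_frag_cmul) (simp add: poly_mapping_eq_iff fun_eq_iff)
  have "to_tau (x_sum n) = (\<Sum>i\<in>{0..<int n}. frag_of (y_coset i) + y_sum)"
    by (simp add: x_sum_def to_tau_def frag_extend_sum comp_def)
  also have "\<dots> = y_sum + frag_cmul (int n) y_sum"
    by (simp add: sum.distrib sum_int_interval_const_frag flip: y_sum_def)
  finally show "to_tau (x_sum n) = frag_cmul (int n + 1) y_sum"
    by (simp add: frag_cmul_distrib)
  show "from_rotations coset_sum = x_sum n"
    by (simp add: coset_sum_def)
  have "from_tau y_sum = (\<Sum>i\<in>{0..<int n}. from_tau (frag_of (y_coset i)))"
    by (simp add: y_sum_def from_tau_def frag_extend_sum comp_def)
  then show "from_tau y_sum = x_sum n"
    by (simp add: x_sum_def)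
qed

lemma augmentation_sums [simp]: "augmentation coset_sum = 2" "augmentation y_sum = int n"
  by (simp_all add: coset_sum_def y_sum_def augmentation_add augmentation_sum)

lemma keys_coset_sum: "Poly_Mapping.keys coset_sum \<subseteq> lcosets rotations"
  unfolding coset_sum_def
  by (rule order_trans [OF keys_add]) (auto simp: lcosets_rotations)

lemma keys_y_sum: "Poly_Mapping.keys y_sum \<subseteq> lcosets tau_group"
  unfolding y_sum_def
  by (rule order_trans [OF keys_sum]) (auto simp: lcosets_tau_group)

lemma rotations_lattice_induct [consumes 1, case_names zero rotations reflections diff]:
  assumes "Poly_Mapping.keys u \<subseteq> lcosets rotations"
    and "P 0" "P (frag_of rotations)" "P (frag_of reflections)" "\<And>a b. \<lbrakk>P a; P b\<rbrakk> \<Longrightarrow> P (a - b)"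
  shows "P u"
  using assms(1) by (induction rule: frag_induction) (use assms in \<open>auto simp: lcosets_rotations\<close>)

lemma tau_lattice_induct [consumes 1, case_names zero y diff]:
  assumes "Poly_Mapping.keys v \<subseteq> lcosets tau_group"
    and "P 0" "\<And>i. \<lbrakk>0 \<le> i; i < int n\<rbrakk> \<Longrightarrow> P (frag_of (y_coset i))" "\<And>a b. \<lbrakk>P a; P b\<rbrakk> \<Longrightarrow> P (a - b)"
  shows "P v"
  using assms(1) by (induction rule: frag_induction) (use assms in \<open>auto simp: lcosets_tau_group\<close>)

lemma basis_mem [simp]:
  "rotations \<in> lcosets rotations" "reflections \<in> lcosets rotations"
  "\<lbrakk>0 \<le> i; i < int n\<rbrakk> \<Longrightarrow> y_coset i \<in> lcosets tau_group"
  "\<lbrakk>0 \<le> i; i < int n\<rbrakk> \<Longrightarrow> Basis_x i \<in> M_plus_basis_set n" "Basis_w \<in> M_plus_basis_set n"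
  by (auto simp: lcosets_rotations lcosets_tau_group M_plus_basis_set_def)

lemmas keys_closed = frag_add_closed frag_diff_closed frag_cmul_closed
  keys_coset_sum keys_y_sum keys_x_sum

lemma to_rotations_closed:
  assumes "Poly_Mapping.keys m \<subseteq> M_plus_basis_set n"
  shows "Poly_Mapping.keys (to_rotations m) \<subseteq> lcosets rotations"
  using assms by (induction rule: M_plus_basis_induct) (simp_all add: keys_closed)

lemma to_tau_closed:
  assumes "Poly_Mapping.keys m \<subseteq> M_plus_basis_set n"
  shows "Poly_Mapping.keys (to_tau m) \<subseteq> lcosets tau_group"
  using assms by (induction rule: M_plus_basis_induct) (simp_all add: keys_closed)

lemma from_rotations_closed:
  assumes "Poly_Mapping.keys u \<subseteq> lcosets rotations"
  shows "Poly_Mapping.keys (from_rotations u) \<subseteq> M_plus_basis_set n"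
  using assms by (induction rule: rotations_lattice_induct) (simp_all add: keys_closed)

lemma from_tau_closed:
  assumes "Poly_Mapping.keys v \<subseteq> lcosets tau_group"
  shows "Poly_Mapping.keys (from_tau v) \<subseteq> M_plus_basis_set n"
  using assms by (induction rule: tau_lattice_induct) (simp_all add: keys_closed)

text \<open>The second sum is the coefficient of \<open>e\<close> after the round trip: it is \<open>-2 c + (1 + n) = 0\<close> for
  \<open>x\<^sub>i\<close> and \<open>c (1 - 2 c) + c n = 0\<close> for \<open>w\<close>.\<close>

lemma from_to:
  assumes "Poly_Mapping.keys m \<subseteq> M_plus_basis_set n"
  shows "from_rotations (to_rotations m) + from_tau (to_tau m) = m"
    and "half * augmentation (to_rotations m) + augmentation (to_tau m) = 0"
proof -
  show "from_rotations (to_rotations m) + from_tau (to_tau m) = m"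
    using assms
  proof (induction rule: M_plus_basis_induct)
    case (diff a b)
    have "from_rotations (to_rotations (a - b)) + from_tau (to_tau (a - b)) =
        (from_rotations (to_rotations a) + from_tau (to_tau a)) -
        (from_rotations (to_rotations b) + from_tau (to_tau b))"
      by simp
    then show ?case using diff by simp
  qed simp_all
  show "half * augmentation (to_rotations m) + augmentation (to_tau m) = 0"
    using assms
    by (induction rule: M_plus_basis_induct)
      (simp_all add: augmentation_add augmentation_diff augmentation_cmul augmentation_uminus
        n_eq algebra_simps)
qed

text \<open>For \<open>a\<^sub>1\<close> this uses the choice of \<open>c\<close>: the image of \<open>X - w\<close> is \<open>(c - n) A - a\<^sub>0 + (1 + n - c) Y\<close>,
  and \<open>c e\<close> contributes \<open>c A - c Y\<close>, which makes \<open>(2 c - n) A - a\<^sub>0 + (1 + n - 2 c) Y = a\<^sub>1\<close>.\<close>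

lemma to_from_rotations:
  assumes "Poly_Mapping.keys u \<subseteq> lcosets rotations"
  shows "to_rotations (from_rotations u) + frag_cmul (half * augmentation u) coset_sum = u"
    and "to_tau (from_rotations u) = frag_cmul (half * augmentation u) y_sum"
proof -
  show "to_rotations (from_rotations u) + frag_cmul (half * augmentation u) coset_sum = u"
    using assms
  proof (induction rule: rotations_lattice_induct)
    case reflections
    then show ?case
      by (simp add: frag_pointwise coset_sum_def n_eq algebra_simps)
  next
    case (diff a b)
    then show ?case
      by (simp add: frag_pointwise augmentation_diff algebra_simps)
  qed simp_all
  show "to_tau (from_rotations u) = frag_cmul (half * augmentation u) y_sum"
    using assms
    by (induction rule: rotations_lattice_induct)
      (simp_all add: frag_pointwise augmentation_diff n_eq algebra_simps)
qed

lemma to_from_tau: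
  assumes "Poly_Mapping.keys v \<subseteq> lcosets tau_group"
  shows "to_rotations (from_tau v) = - frag_cmul (augmentation v) coset_sum"
    and "to_tau (from_tau v) = v + frag_cmul (augmentation v) y_sum"
  using assms
  by (induction rule: tau_lattice_induct)
    (simp_all add: frag_pointwise augmentation_diff algebra_simps)

lemma translate_sums [simp]:
  "translate \<sigma> coset_sum = coset_sum" "translate \<tau> coset_sum = coset_sum"
  "translate \<sigma> y_sum = y_sum" "translate \<tau> y_sum = y_sum"
proof -
  show "translate \<sigma> coset_sum = coset_sum" "translate \<tau> coset_sum = coset_sum"
    using sigma_pow_rotations [of 1]
    by (simp_all add: coset_sum_def frag_extend_add sigma_reflections tau_reflections)
  have "(\<Sum>i\<in>{0..<int n}. frag_of (y_coset (i + 1))) = y_sum"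
    "(\<Sum>i\<in>{0..<int n}. frag_of (y_coset (- i))) = y_sum"
    using sum_int_mod_shift [OF n_pos, of "\<lambda>i. frag_of (y_coset i)"]
      sum_int_mod_negate [OF n_pos, of "\<lambda>i. frag_of (y_coset i)"]
    by (simp_all add: y_coset_mod y_sum_def)
  then show "translate \<sigma> y_sum = y_sum" "translate \<tau> y_sum = y_sum"
    by (simp_all add: y_sum_def frag_extend_sum comp_def sigma_y_coset tau_y_coset)
qed

text \<open>The value of \<open>c\<close> matters for the image of \<open>w\<close> under \<open>\<tau>\<close>: both
  sides equal \<open>a\<^sub>1 - c A\<close>, by \<open>2 c - n = 1\<close>.\<close>

lemma to_rotations_equivariant:
  assumes "Poly_Mapping.keys m \<subseteq> M_plus_basis_set n"
  shows "to_rotations (M_plus_sigma n m) = translate \<sigma> (to_rotations m)"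
    and "to_rotations (M_plus_tau n m) = translate \<tau> (to_rotations m)"
proof -
  show "to_rotations (M_plus_sigma n m) = translate \<sigma> (to_rotations m)"
    using assms sigma_pow_rotations [of 1]
    by (induction rule: M_plus_basis_induct)
      (simp_all add: frag_extend_diff frag_extend_minus frag_extend_cmul)
  show "to_rotations (M_plus_tau n m) = translate \<tau> (to_rotations m)"
    using assms
  proof (induction rule: M_plus_basis_induct)
    case w
    show ?case
      by (simp add: frag_extend_diff frag_extend_cmul)
        (simp add: frag_pointwise n_eq coset_sum_def algebra_simps)
  qed (simp_all add: frag_extend_diff frag_extend_minus)
qed

lemma to_tau_equivariant:
  assumes "Poly_Mapping.keys m \<subseteq> M_plus_basis_set n"
  shows "to_tau (M_plus_sigma n m) = translate \<sigma> (to_tau m)"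
    and "to_tau (M_plus_tau n m) = translate \<tau> (to_tau m)"
proof -
  show "to_tau (M_plus_sigma n m) = translate \<sigma> (to_tau m)"
    using assms
    by (induction rule: M_plus_basis_induct)
      (simp_all add: frag_extend_diff frag_extend_add frag_extend_cmul sigma_y_coset y_coset_mod)
  show "to_tau (M_plus_tau n m) = translate \<tau> (to_tau m)"
    using assms
  proof (induction rule: M_plus_basis_induct)
    case w
    show ?case
      by (simp add: frag_extend_cmul) (simp add: frag_pointwise n_eq algebra_simps)
  qed (simp_all add: frag_extend_diff frag_extend_add tau_y_coset y_coset_mod)
qed

definition lattice_iso :: "(M_plus_basis \<Rightarrow>\<^sub>0 int) \<times> int \<Rightarrow> ('a set \<Rightarrow>\<^sub>0 int) \<times> ('a set \<Rightarrow>\<^sub>0 int)" where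
  "lattice_iso = (\<lambda>(m, k).
    (to_rotations m + frag_cmul k coset_sum, to_tau m - frag_cmul k y_sum))"

definition lattice_iso_inverse ::
  "('a set \<Rightarrow>\<^sub>0 int) \<times> ('a set \<Rightarrow>\<^sub>0 int) \<Rightarrow> (M_plus_basis \<Rightarrow>\<^sub>0 int) \<times> int" where
  "lattice_iso_inverse = (\<lambda>(u, v).
    (from_rotations u + from_tau v, half * augmentation u + augmentation v))"

abbreviation source :: "('a \<Rightarrow>\<^sub>0 int, (M_plus_basis \<Rightarrow>\<^sub>0 int) \<times> int) module" where
  "source \<equiv> module_direct_sum (M_plus n G \<sigma> \<tau>) trivial_lattice"

abbreviation target :: "('a \<Rightarrow>\<^sub>0 int, ('a set \<Rightarrow>\<^sub>0 int) \<times> ('a set \<Rightarrow>\<^sub>0 int)) module" where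
  "target \<equiv> module_direct_sum (permutation_lattice G rotations) (permutation_lattice G tau_group)"

lemma source_cases:
  assumes "x \<in> carrier source"
  obtains m k where "x = (m, k)" "Poly_Mapping.keys m \<subseteq> M_plus_basis_set n"
  using assms by (cases x) (auto simp: M_plus_def free_abelian_module_simps)

lemma target_cases:
  assumes "y \<in> carrier target"
  obtains u v where "y = (u, v)" "Poly_Mapping.keys u \<subseteq> lcosets rotations"
    "Poly_Mapping.keys v \<subseteq> lcosets tau_group"
  using assms by (cases y) (auto simp: permutation_lattice_def free_abelian_module_simps)

lemma bij_lattice_iso: "bij_betw lattice_iso (carrier source) (carrier target)"
proof (rule bij_betw_byWitness [of _ lattice_iso_inverse])
  show "\<forall>x\<in>carrier source. lattice_iso_inverse (lattice_iso x) = x"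
  proof
    fix x assume "x \<in> carrier source"
    then obtain m k where x: "x = (m, k)" and m: "Poly_Mapping.keys m \<subseteq> M_plus_basis_set n"
      by (rule source_cases)
    show "lattice_iso_inverse (lattice_iso x) = x"
      using from_to [OF m]
      by (simp add: x lattice_iso_def lattice_iso_inverse_def augmentation_add augmentation_diff
          augmentation_cmul n_eq algebra_simps)
  qed
  show "\<forall>y\<in>carrier target. lattice_iso (lattice_iso_inverse y) = y"
  proof
    fix y assume "y \<in> carrier target"
    then obtain u v where y: "y = (u, v)" and u: "Poly_Mapping.keys u \<subseteq> lcosets rotations"
      and v: "Poly_Mapping.keys v \<subseteq> lcosets tau_group"
      by (rule target_cases)
    have "to_rotations (from_rotations u + from_tau v) +
        frag_cmul (half * augmentation u + augmentation v) coset_sum =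
        to_rotations (from_rotations u) + frag_cmul (half * augmentation u) coset_sum"
      using to_from_tau [OF v]
      by (simp add: frag_cmul_distrib) (simp flip: frag_cmul_distrib)
    moreover have "to_tau (from_rotations u + from_tau v) -
        frag_cmul (half * augmentation u + augmentation v) y_sum = v"
      using to_from_tau [OF v] to_from_rotations [OF u] by (simp add: frag_cmul_distrib)
    ultimately show "lattice_iso (lattice_iso_inverse y) = y"
      using to_from_rotations [OF u] by (simp add: y lattice_iso_def lattice_iso_inverse_def)
  qed
  show "lattice_iso ` carrier source \<subseteq> carrier target"
  proof (rule image_subsetI)
    fix x assume "x \<in> carrier source"
    then obtain m k where x: "x = (m, k)" and m: "Poly_Mapping.keys m \<subseteq> M_plus_basis_set n"
      by (rule source_cases)
    show "lattice_iso x \<in> carrier target"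
      using m by (simp add: x lattice_iso_def permutation_lattice_def free_abelian_module_simps
          keys_closed to_rotations_closed to_tau_closed)
  qed
  show "lattice_iso_inverse ` carrier target \<subseteq> carrier source"
  proof (rule image_subsetI)
    fix y assume "y \<in> carrier target"
    then obtain u v where y: "y = (u, v)" and uv: "Poly_Mapping.keys u \<subseteq> lcosets rotations"
      "Poly_Mapping.keys v \<subseteq> lcosets tau_group"
      by (rule target_cases)
    show "lattice_iso_inverse y \<in> carrier source"
      using uv by (simp add: y lattice_iso_inverse_def M_plus_def trivial_lattice_simps
          free_abelian_module_simps keys_closed from_rotations_closed from_tau_closed)
  qed
qed

lemma G_lattice_source: "G_lattice G source"
  by (rule G_lattice_direct_sum [OF G_lattice_M_plus G_lattice_trivial])

lemma G_lattice_target: "G_lattice G target"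
  by (intro G_lattice_direct_sum G_lattice_permutation subgroup_rotations subgroup_tau_group)
    (simp_all add: lcosets_rotations lcosets_tau_group)

lemma lattice_iso_in_module_iso: "lattice_iso \<in> module_iso (group_ring G) source target"
proof -
  have hom: "lattice_iso \<in> hom (add_monoid source) (add_monoid target)"
    using bij_betwE [OF bij_lattice_iso]
    by (auto simp: hom_def lattice_iso_def M_plus_def permutation_lattice_def trivial_lattice_simps
        free_abelian_module_simps frag_cmul_distrib)
  have "lattice_iso (frag_of g \<odot>\<^bsub>source\<^esub> x) = frag_of g \<odot>\<^bsub>target\<^esub> lattice_iso x"
    if g: "g \<in> {\<sigma>, \<tau>}" and x: "x \<in> carrier source" for g x
  proof -
    from x obtain m k where x: "x = (m, k)" and m: "Poly_Mapping.keys m \<subseteq> M_plus_basis_set n"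
      by (rule source_cases)
    have "frag_of \<sigma> \<odot>\<^bsub>source\<^esub> x = (M_plus_sigma n m, k)" "frag_of \<tau> \<odot>\<^bsub>source\<^esub> x = (M_plus_tau n m, k)"
      using M_plus_action_sigma [of m] M_plus_action_tau [of m] m
      by (simp_all add: x M_plus_def free_abelian_module_simps trivial_lattice_simps
          flip: M_plus_action_def)
    moreover have "frag_of g \<odot>\<^bsub>target\<^esub> (u, v) = (translate g u, translate g v)" for u v
      by (simp add: permutation_lattice_def free_abelian_module_simps)
    ultimately show ?thesis
      using g to_rotations_equivariant [OF m] to_tau_equivariant [OF m]
      by (auto simp: x lattice_iso_def frag_extend_add frag_extend_diff frag_extend_cmul)
  qed
  then have linear: "lattice_iso (a \<odot>\<^bsub>source\<^esub> x) = a \<odot>\<^bsub>target\<^esub> lattice_iso x"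
    if "a \<in> carrier (group_ring G)" "x \<in> carrier source" for a x
    using group_ring_linear_if_generators [OF _ _ hom generators, of a x] that
      G_lattice_source G_lattice_target by (simp add: G_lattice_def)
  have "lattice_iso \<in> iso (add_monoid source) (add_monoid target)"
    unfolding iso_def using hom bij_lattice_iso by simp
  with linear show ?thesis
    unfolding module_iso_def by blast
qed

end

theorem theorem3p4:
  fixes n :: nat and G :: "('g, 'm) monoid_scheme" and \<sigma> \<tau> :: 'g
  assumes "n \<ge> 3" and "odd n"
    and "dihedral_presentation n G \<sigma> \<tau>"
  shows "G_lattice_isomorphic G
           (module_direct_sum (M_plus n G \<sigma> \<tau>) trivial_lattice)
           (module_direct_sum (permutation_lattice G (generate G {\<sigma>}))
                              (permutation_lattice G (generate G {\<tau>})))"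
proof -
  have "group G"
    using assms(3) by (simp add: dihedral_presentation_def has_presentation_def)
  then interpret odd_dihedral_group G n \<sigma> \<tau>
    using assms
    by (simp add: odd_dihedral_group_def dihedral_group_def dihedral_group_axioms_def
        odd_dihedral_group_axioms_def)
  show ?thesis
    unfolding G_lattice_isomorphic_def
    using G_lattice_source G_lattice_target lattice_iso_in_module_iso by blast
qed

end
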